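(* Let $X$ be a non-locally convex quasi-Banach space and let $I=[0,1]$. Then there exists a function $f:I\to X$ that is continuous and Riemann-integrable such that its average function $\operatorname{Ave}[f]:I\times I\to X$ is bounded and separately continuous but fails to be jointly continuous.
   Context: Quasi-Banach spaces are real: $X$ is a real vector space with a complete quasi-norm $\|\cdot\|$ (i.e. $\|x\|>0$ for $x\ne0$, $\|\alpha x\|=|\alpha|\|x\|$, $\|x+y\|\le\kappa(\|x\|+\|y\|)$ for some constant $\kappa\ge1$), with the vector topology induced by the quasi-norm; $X$ is non-locally convex if this topology is not locally convex (equivalently, $X$ is not isomorphic to a Banach space). A function $f:[a,b]\to X$ is Riemann-integrable if its Riemann sums over tagged partitions converge in $X$ as the mesh of the partition tends to $0$; the limit is $\int_a^b f(u)\,du$. A function that is Riemann-integrable on $I$ is Riemann-integrable on each compact subinterval. For $f:I\to X$ continuous and Riemann-integrable, the average function $\operatorname{Ave}[f]:I\times I\to X$ is defined by $$\operatorname{Ave}[f](s,t)=\begin{cases}\frac{1}{t-s}\int_s^t f(u)\,du, & 0\le s<t\le 1,\\ f(c), & 0\le s=t=c\le 1,\\ \frac{1}{s-t}\int_t^s f(u)\,du, & 0\le t<s\le 1.\end{cases}$$ It is bounded if $\sup_{0\le s,t\le1}\|\operatorname{Ave}[f](s,t)\|<\infty$; separately continuous if for all $s_0,t_0\in I$, $\lim_{s\to s_0}\operatorname{Ave}[f](s,t_0)=\lim_{t\to t_0}\operatorname{Ave}[f](s_0,t)=\operatorname{Ave}[f](s_0,t_0)$; jointly continuous if it is continuous as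 a map from $I\times I$ to $X$. *)

theory Defs
  imports "HOL-Analysis.Analysis"
begin

definition quasi_norm :: "('a::real_vector \<Rightarrow> real) \<Rightarrow> bool" where
  "quasi_norm N \<longleftrightarrow>
     (\<forall>x. x \<noteq> 0 \<longrightarrow> 0 < N x) \<and>
     (\<forall>\<alpha> x. N (\<alpha> *\<^sub>R x) = \<bar>\<alpha>\<bar> * N x) \<and>
     (\<exists>\<kappa>\<ge>1. \<forall>x y. N (x + y) \<le> \<kappa> * (N x + N y))"

definition quasi_complete :: "('a::real_vector \<Rightarrow> real) \<Rightarrow> bool" where
  "quasi_complete N \<longleftrightarrow>
     (\<forall>x :: nat \<Rightarrow> 'a.
        (\<forall>\<epsilon>>0. \<exists>M. \<forall>m\<ge>M. \<forall>n\<ge>M. N (x m - x n) < \<epsilon>) \<longrightarrow>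
        (\<exists>l. (\<lambda>n. N (x n - l)) \<longlonglongrightarrow> 0))"

definition quasi_banach :: "('a::real_vector \<Rightarrow> real) \<Rightarrow> bool" where
  "quasi_banach N \<longleftrightarrow> quasi_norm N \<and> quasi_complete N"

text \<open>A quasi-norm need not be continuous, so its balls need not be open: the induced
  topology consists of the sets that contain a ball around each of their points, and
  the balls around a point form a base of (not necessarily open) neighbourhoods of it.\<close>

definition quasi_topology :: "('a::real_vector \<Rightarrow> real) \<Rightarrow> 'a topology" where
  "quasi_topology N =
     topology (\<lambda>U. \<forall>x\<in>U. \<exists>\<epsilon>>0. \<forall>y. N (y - x) < \<epsilon> \<longrightarrow> y \<in> U)"

lemma openin_quasi_topology:
  "openin (quasi_topology N) U \<longleftrightarrow> (\<forall>x\<in>U. \<exists>\<epsilon>>0. \<forall>y. N (y - x) < \<epsilon> \<longrightarrow> y \<in> U)"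
proof -
  have "istopology (\<lambda>U. \<forall>x\<in>U. \<exists>\<epsilon>>0. \<forall>y. N (y - x) < \<epsilon> \<longrightarrow> y \<in> U)"
    unfolding istopology_def
  proof (intro conjI allI impI ballI)
    fix S T x
    assume "\<forall>x\<in>S. \<exists>\<epsilon>>0. \<forall>y. N (y - x) < \<epsilon> \<longrightarrow> y \<in> S"
      and "\<forall>x\<in>T. \<exists>\<epsilon>>0. \<forall>y. N (y - x) < \<epsilon> \<longrightarrow> y \<in> T" and "x \<in> S \<inter> T"
    then obtain d e where "d > 0" "\<forall>y. N (y - x) < d \<longrightarrow> y \<in> S"
      and "e > 0" "\<forall>y. N (y - x) < e \<longrightarrow> y \<in> T" by blast
    then show "\<exists>\<epsilon>>0. \<forall>y. N (y - x) < \<epsilon> \<longrightarrow> y \<in> S \<inter> T"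
      by (intro exI[of _ "min d e"]) auto
  next
    fix K x
    assume "\<forall>S\<in>K. \<forall>x\<in>S. \<exists>\<epsilon>>0. \<forall>y. N (y - x) < \<epsilon> \<longrightarrow> y \<in> S" and "x \<in> \<Union>K"
    then show "\<exists>\<epsilon>>0. \<forall>y. N (y - x) < \<epsilon> \<longrightarrow> y \<in> \<Union>K" by (meson Union_iff)
  qed
  then show ?thesis
    by (simp add: quasi_topology_def topology_inverse')
qed

lemma topspace_quasi_topology [simp]: "topspace (quasi_topology N) = UNIV"
proof -
  have "openin (quasi_topology N) UNIV"
    by (auto simp: openin_quasi_topology intro: exI[of _ "1::real"])
  then show ?thesis using openin_subset by blast
qed

abbreviation locally_convex :: "('a::real_vector) topology \<Rightarrow> bool" where
  "locally_convex T \<equiv> neighbourhood_base_of convex T"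

text \<open>The Lebesgue measure of an interval is its length, so the bound on the
  measures is the bound on the mesh. The degenerate intervals allowed in a tagged
  division contribute nothing to the Riemann sum.\<close>

definition has_riemann_integral ::
    "('a::real_vector \<Rightarrow> real) \<Rightarrow> (real \<Rightarrow> 'a) \<Rightarrow> 'a \<Rightarrow> real \<Rightarrow> real \<Rightarrow> bool" where
  "has_riemann_integral N f L a b \<longleftrightarrow>
     (\<forall>\<epsilon>>0. \<exists>\<delta>>0. \<forall>p.
        p tagged_division_of {a..b} \<and> (\<forall>(x, K)\<in>p. measure lborel K < \<delta>) \<longrightarrow>
        N ((\<Sum>(x, K)\<in>p. measure lborel K *\<^sub>R f x) - L) < \<epsilon>)"

definition riemann_integrable ::
    "('a::real_vector \<Rightarrow> real) \<Rightarrow> (real \<Rightarrow> 'a) \<Rightarrow> real \<Rightarrow> real \<Rightarrow> bool" where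
  "riemann_integrable N f a b \<longleftrightarrow> (\<exists>L. has_riemann_integral N f L a b)"

definition riemann_integral ::
    "('a::real_vector \<Rightarrow> real) \<Rightarrow> (real \<Rightarrow> 'a) \<Rightarrow> real \<Rightarrow> real \<Rightarrow> 'a" where
  "riemann_integral N f a b = (THE L. has_riemann_integral N f L a b)"

definition Ave ::
    "('a::real_vector \<Rightarrow> real) \<Rightarrow> (real \<Rightarrow> 'a) \<Rightarrow> real \<times> real \<Rightarrow> 'a" where
  "Ave N f = (\<lambda>(s, t).
     if s < t then (1 / (t - s)) *\<^sub>R riemann_integral N f s t
     else if t < s then (1 / (s - t)) *\<^sub>R riemann_integral N f t s
     else f s)"

definition bounded_on_square ::
    "('a::real_vector \<Rightarrow> real) \<Rightarrow> (real \<times> real \<Rightarrow> 'a) \<Rightarrow> bool" where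
  "bounded_on_square N F \<longleftrightarrow> bdd_above ((\<lambda>z. N (F z)) ` ({0..1} \<times> {0..1}))"

definition separately_continuous ::
    "('a::real_vector \<Rightarrow> real) \<Rightarrow> (real \<times> real \<Rightarrow> 'a) \<Rightarrow> bool" where
  "separately_continuous N F \<longleftrightarrow>
     (\<forall>s\<^sub>0\<in>{0..1}. \<forall>t\<^sub>0\<in>{0..1}.
        limitin (quasi_topology N) (\<lambda>s. F (s, t\<^sub>0)) (F (s\<^sub>0, t\<^sub>0)) (at s\<^sub>0 within {0..1}) \<and>
        limitin (quasi_topology N) (\<lambda>t. F (s\<^sub>0, t)) (F (s\<^sub>0, t\<^sub>0)) (at t\<^sub>0 within {0..1}))"

definition jointly_continuous ::
    "('a::real_vector \<Rightarrow> real) \<Rightarrow> (real \<times> real \<Rightarrow> 'a) \<Rightarrow> bool" where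
  "jointly_continuous N F \<longleftrightarrow>
     continuous_map (top_of_set ({0..1} \<times> {0..1})) (quasi_topology N) F"

end

theory Submission
  imports Defs
begin

text \<open>Since the space is not locally convex, the convex hull of its unit ball is unbounded. If
  \<open>y = (\<Sum>j<k. l j *\<^sub>R x j)\<close> is a convex combination of unit vectors of large quasi-norm, then placing
  a small bump in direction \<open>x j\<close> on a subinterval of length proportional to \<open>l j\<close> gives a uniformly
  small function with large averages; it is divided by the supremum of the quasi-norms of its
  averages. Infinitely many such blocks, on tiny intervals accumulating at 0, are added up.
  The averages over the individual blocks do not tend to 0, so \<open>Ave\<close> is not jointly continuous at
  \<open>(0, 0)\<close>. An average over an interval with end point 0 is small, as the intervals of the blocks
  leave gaps and the integrals of the blocks decay fast, and away from 0 the sum is locally a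
  finite-dimensional continuous function.\<close>

text \<open>Without local convexity, uniform smallness of a function does not make its Riemann sums
  small. Hence every block carries two separate bounds: one on its Riemann sums, uniform over all
  divisions, which makes the series integrable, and one on its averages, which makes the primitive
  Lipschitz. The first becomes small once the values are small and the block is short, whereas
  averages do not change when a block is shortened; this is how averages of quasi-norm at least 1/2
  survive in blocks with tiny values and integrals. Dividing by the supremum over all subintervals,
  and not by one large average, is what keeps every average at most 1. Since each addition costs a
  factor \<kappa>, block number k gets size (1/8)^k / \<kappa>^(k + 3): the power of \<kappa> pays
  for sums and limits, and (1/8)^k is negligible against the scale (1/2)^k at which the block
  sits.\<close>

section \<open>Riemann sums and the real-valued case\<close>

definition riemann_sum :: "(real \<Rightarrow> 'a::real_vector) \<Rightarrow> (real \<times> real set) set \<Rightarrow> 'a" where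
  "riemann_sum f p = (\<Sum>(x, K)\<in>p. measure lborel K *\<^sub>R f x)"

lemma has_riemann_integralI:
  assumes "\<And>\<epsilon>. \<epsilon> > 0 \<Longrightarrow> \<exists>\<delta>>0. \<forall>p. p tagged_division_of {a..b} \<longrightarrow>
      (\<forall>(x, K)\<in>p. measure lborel K < \<delta>) \<longrightarrow> N (riemann_sum f p - L) < \<epsilon>"
  shows "has_riemann_integral N f L a b"
  using assms unfolding has_riemann_integral_def riemann_sum_def by meson

lemma has_riemann_integralE:
  assumes "has_riemann_integral N f L a b" "\<epsilon> > 0"
  obtains \<delta> where "\<delta> > 0"
    "\<And>p. p tagged_division_of {a..b} \<Longrightarrow> (\<And>x K. (x, K)\<in>p \<Longrightarrow> measure lborel K < \<delta>)
      \<Longrightarrow> N (riemann_sum f p - L) < \<epsilon>"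
proof -
  from assms obtain \<delta> where "\<delta> > 0" and \<delta>: "\<And>p. p tagged_division_of {a..b} \<and>
      (\<forall>(x, K)\<in>p. measure lborel K < \<delta>) \<Longrightarrow> N (riemann_sum f p - L) < \<epsilon>"
    unfolding has_riemann_integral_def riemann_sum_def by meson
  show ?thesis
    by (rule that[OF \<open>\<delta> > 0\<close>], rule \<delta>) auto
qed

text \<open>Such divisions keep the limit over the mesh from being vacuous; uniqueness of the
  integral and bounds on it rest on them. An interval inside a ball of radius \<delta>/3 around its
  tag has length below \<delta>.\<close>

lemma fine_tagged_division_exists:
  fixes a b \<delta> :: real
  assumes "\<delta> > 0"
  obtains p where "p tagged_division_of {a..b}" "\<And>x K. (x, K) \<in> p \<Longrightarrow> measure lborel K < \<delta>"
proof -
  have "gauge (\<lambda>x::real. ball x (\<delta>/3))"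
    using assms by (simp add: gauge_ball)
  from fine_division_exists_real[OF this, of a b]
  obtain p where p: "p tagged_division_of {a..b}" "(\<lambda>x. ball x (\<delta>/3)) fine p" by blast
  have "measure lborel K < \<delta>" if xK: "(x, K) \<in> p" for x K
  proof -
    have "K \<subseteq> ball x (\<delta>/3)" using p(2) that by (auto simp: fine_def)
    moreover obtain c d where K: "K = {c..d}"
      using tagged_division_ofD(4)[OF p(1) xK] by auto
    moreover have "x \<in> K" using tagged_division_ofD(2)[OF p(1) that] .
    ultimately have "c \<in> ball x (\<delta>/3)" "d \<in> ball x (\<delta>/3)" "c \<le> d"
      unfolding subset_iff by auto
    then have "\<bar>x - c\<bar> < \<delta>/3" "\<bar>x - d\<bar> < \<delta>/3" "c \<le> d" by (simp_all add: dist_real_def)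
    then have "d - c < \<delta>" using assms by linarith
    then show ?thesis using K \<open>c \<le> d\<close> by simp
  qed
  with p(1) show ?thesis by (rule that)
qed

lemma riemann_sum_cong:
  assumes "p tagged_division_of S" "\<And>x. x \<in> S \<Longrightarrow> f x = g x"
  shows "riemann_sum f p = riemann_sum g p"
  unfolding riemann_sum_def
proof (rule sum.cong[OF refl])
  fix z assume z: "z \<in> p"
  obtain x K where "z = (x, K)" by (cases z)
  with z assms tagged_division_ofD(2,3)[OF assms(1), of x K]
  show "(case z of (x, K) \<Rightarrow> measure lborel K *\<^sub>R f x) = (case z of (x, K) \<Rightarrow> measure lborel K *\<^sub>R g x)"
    by auto
qed

lemma has_riemann_integral_cong:
  assumes "has_riemann_integral N f L a b" "\<And>x. x \<in> {a..b} \<Longrightarrow> f x = g x"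
  shows "has_riemann_integral N g L a b"
proof (rule has_riemann_integralI)
  fix \<epsilon> :: real assume "\<epsilon> > 0"
  with assms(1) obtain \<delta> where "\<delta> > 0" and
    \<delta>: "\<And>p. p tagged_division_of {a..b} \<Longrightarrow> (\<And>x K. (x, K)\<in>p \<Longrightarrow> measure lborel K < \<delta>)
      \<Longrightarrow> N (riemann_sum f p - L) < \<epsilon>"
    using has_riemann_integralE by blast
  have "N (riemann_sum g p - L) < \<epsilon>"
    if p: "p tagged_division_of {a..b}" and "\<forall>(x, K)\<in>p. measure lborel K < \<delta>" for p
    using \<delta>[OF p] that(2) riemann_sum_cong[OF p assms(2)] by auto
  with \<open>\<delta> > 0\<close> show "\<exists>\<delta>>0. \<forall>p. p tagged_division_of {a..b} \<longrightarrow>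
      (\<forall>(x, K)\<in>p. measure lborel K < \<delta>) \<longrightarrow> N (riemann_sum g p - L) < \<epsilon>" by blast
qed

lemma riemann_sum_add: "riemann_sum (\<lambda>u. f u + g u) p = riemann_sum f p + riemann_sum g p"
  by (simp add: riemann_sum_def scaleR_add_right sum.distrib case_prod_unfold)

lemma riemann_sum_zero: "riemann_sum (\<lambda>u. 0) p = 0"
  by (simp add: riemann_sum_def)

lemma riemann_sum_scaleR: "riemann_sum (\<lambda>u. c *\<^sub>R f u) p = c *\<^sub>R riemann_sum f p"
  by (simp add: riemann_sum_def scaleR_sum_right case_prod_unfold mult.commute)

lemma riemann_sum_scaleR_const: "riemann_sum (\<lambda>u. \<phi> u *\<^sub>R x) p = riemann_sum \<phi> p *\<^sub>R x"
  by (simp add: riemann_sum_def scaleR_sum_left case_prod_unfold)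

lemma riemann_sum_sum: "riemann_sum (\<lambda>u. \<Sum>k\<in>A. f k u) p = (\<Sum>k\<in>A. riemann_sum (f k) p)"
  unfolding riemann_sum_def case_prod_unfold scaleR_sum_right by (rule sum.swap)

text \<open>Links Riemann sums to \<open>integral\<close>, with \<open>abs\<close> as the quasi-norm
  of the reals, so that real calculus becomes available. By uniform continuity each interval
  contributes an error of at most \<eta> times its length, and the lengths add up to b - a.\<close>

lemma continuous_has_riemann_integral:
  fixes \<phi> :: "real \<Rightarrow> real"
  assumes "continuous_on {a..b} \<phi>" "a \<le> b"
  shows "has_riemann_integral abs \<phi> (integral {a..b} \<phi>) a b"
proof (rule has_riemann_integralI)
  fix \<epsilon> :: real assume "\<epsilon> > 0"
  \<comment> \<open>The summand 1 covers a = b and makes the final estimate strict.\<close>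
  define \<eta> where "\<eta> = \<epsilon> / (b - a + 1)"
  have "\<eta> > 0" using \<open>\<epsilon> > 0\<close> assms(2) by (simp add: \<eta>_def)
  have "uniformly_continuous_on {a..b} \<phi>"
    using assms(1) by (simp add: compact_uniformly_continuous)
  with \<open>\<eta> > 0\<close> obtain \<delta> where "\<delta> > 0"
    and \<delta>: "\<And>x y. x \<in> {a..b} \<Longrightarrow> y \<in> {a..b} \<Longrightarrow> dist y x < \<delta> \<Longrightarrow> dist (\<phi> y) (\<phi> x) < \<eta>"
    unfolding uniformly_continuous_on_def by meson
  have "\<bar>riemann_sum \<phi> p - integral {a..b} \<phi>\<bar> < \<epsilon>"
    if p: "p tagged_division_of {a..b}" and fine: "\<forall>(x, K)\<in>p. measure lborel K < \<delta>" for p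
  proof -
    have int: "integral {a..b} \<phi> = (\<Sum>(x, K)\<in>p. integral K \<phi>)"
      using integral_combine_tagged_division_topdown[of \<phi> a b p] p
        integrable_continuous_interval[OF assms(1)] by simp
    have "\<bar>measure lborel K *\<^sub>R \<phi> x - integral K \<phi>\<bar> \<le> \<eta> * measure lborel K" if xK: "(x, K) \<in> p" for x K
    proof -
      obtain c d where K: "K = {c..d}"
        using tagged_division_ofD(4)[OF p xK] by auto
      have x: "x \<in> {c..d}" and sub: "{c..d} \<subseteq> {a..b}"
        using tagged_division_ofD(2,3)[OF p that] K by auto
      have cd: "c \<le> d" "d - c < \<delta>" using x fine that K by auto
      have cont: "continuous_on {c..d} \<phi>" using assms(1) sub by (rule continuous_on_subset)
      have "norm (\<phi> u - \<phi> x) \<le> \<eta>" if "u \<in> cbox c d" for u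
        using \<delta>[of x u] that x sub cd by (force simp: dist_real_def)
      then have "norm (integral (cbox c d) (\<lambda>u. \<phi> u - \<phi> x)) \<le> \<eta> * measure lborel (cbox c d)"
        using \<open>\<eta> > 0\<close> by (intro integrable_bound) (auto intro!: integrable_continuous_interval
            continuous_intros cont)
      moreover have "integral {c..d} (\<lambda>u. \<phi> u - \<phi> x) = integral K \<phi> - measure lborel K *\<^sub>R \<phi> x"
        unfolding K by (subst integral_diff) (auto intro!: integrable_continuous_interval cont simp: K cd)
      ultimately show ?thesis unfolding K by (simp add: abs_minus_commute)
    qed
    then have "\<bar>\<Sum>(x, K)\<in>p. measure lborel K *\<^sub>R \<phi> x - integral K \<phi>\<bar> \<le> (\<Sum>(x, K)\<in>p. \<eta> * measure lborel K)"
      by (intro order_trans[OF sum_abs] sum_mono) (auto simp: case_prod_unfold)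
    also have "\<dots> = \<eta> * (b - a)"
      using additive_content_tagged_division[of p a b] p assms(2)
      by (simp add: case_prod_unfold flip: sum_distrib_left)
    also have "\<dots> < \<epsilon>"
    proof -
      have "\<eta> * (b - a) < \<eta> * (b - a + 1)" using \<open>\<eta> > 0\<close> by simp
      also have "\<dots> = \<epsilon>" using assms(2) by (simp add: \<eta>_def)
      finally show ?thesis .
    qed
    finally show ?thesis
      unfolding int riemann_sum_def by (simp add: sum_subtractf case_prod_unfold)
  qed
  with \<open>\<delta> > 0\<close> show "\<exists>\<delta>>0. \<forall>p. p tagged_division_of {a..b} \<longrightarrow>
      (\<forall>(x, K)\<in>p. measure lborel K < \<delta>) \<longrightarrow> \<bar>riemann_sum \<phi> p - integral {a..b} \<phi>\<bar> < \<epsilon>" by blast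
qed

lemma bump_exists:
  fixes c w :: real
  assumes "0 \<le> c" "0 \<le> w" "c + w \<le> 1"
  shows "\<exists>\<phi>. continuous_on {0..1} \<phi> \<and> (\<forall>u. 0 \<le> \<phi> u \<and> \<phi> u \<le> 1) \<and>
    (\<forall>u. u \<notin> {c<..<c + w} \<longrightarrow> \<phi> u = 0) \<and> integral {0..1} \<phi> = w / 6"
proof (cases "w = 0")
  case True
  then show ?thesis by (intro exI[of _ "\<lambda>u. 0"]) auto
next
  case False
  with assms have w: "w > 0" by simp
  define v where "v u = (u - c) / w" for u
  define \<phi> where "\<phi> u = max 0 (v u * (1 - v u))" for u
  have "continuous_on {0..1} \<phi>"
    unfolding \<phi>_def v_def using w by (intro continuous_intros) auto
  moreover have "v u * (1 - v u) \<le> 1" for u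
    using zero_le_power2[of "v u - 1/2"] by (simp add: power2_eq_square algebra_simps)
  then have "0 \<le> \<phi> u \<and> \<phi> u \<le> 1" for u unfolding \<phi>_def by simp
  moreover have out: "\<phi> u = 0" if "u \<notin> {c<..<c + w}" for u
  proof -
    have "v u \<le> 0 \<or> v u \<ge> 1" using that w by (auto simp: v_def field_simps)
    then have "v u * (1 - v u) \<le> 0" by (auto simp: mult_le_0_iff)
    then show ?thesis by (simp add: \<phi>_def)
  qed
  moreover have "integral {0..1} \<phi> = w / 6"
  proof -
    define G where "G u = w * ((v u)^2 / 2 - (v u)^3 / 3)" for u
    have "(G has_vector_derivative v u * (1 - v u)) (at u within {c..c+w})" for u
      unfolding G_def v_def using w
      by (auto intro!: derivative_eq_intros simp flip: has_real_derivative_iff_has_vector_derivative)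
        (simp add: field_simps power2_eq_square)
    then have "((\<lambda>u. v u * (1 - v u)) has_integral G (c + w) - G c) {c..c + w}"
      using w by (intro fundamental_theorem_of_calculus) auto
    moreover have "G (c + w) - G c = w / 6" using w by (simp add: G_def v_def)
    moreover have "v u * (1 - v u) = \<phi> u" if "u \<in> {c..c + w}" for u
    proof -
      have "0 \<le> v u" "v u \<le> 1" using that w by (auto simp: v_def)
      then show ?thesis by (simp add: \<phi>_def)
    qed
    ultimately have "(\<phi> has_integral w / 6) {c..c + w}"
      by (metis (no_types, lifting) has_integral_cong)
    then have "(\<phi> has_integral w / 6) {0..1}"
      by (rule has_integral_on_superset) (use out assms in auto)
    then show ?thesis by (rule integral_unique)
  qed
  ultimately show ?thesis by blast
qed

section \<open>Quasi-norms, finite sums and integrals\<close>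

text \<open>One admissible constant \<kappa> is fixed, since the sizes of the blocks are chosen in
  terms of its powers.\<close>

locale quasi_normed =
  fixes N :: "'a::real_vector \<Rightarrow> real" and \<kappa> :: real
  assumes N_pos: "x \<noteq> 0 \<Longrightarrow> 0 < N x"
    and N_scaleR: "N (c *\<^sub>R x) = \<bar>c\<bar> * N x"
    and \<kappa>_ge_1: "\<kappa> \<ge> 1"
    and N_triangle: "N (x + y) \<le> \<kappa> * (N x + N y)"
begin

lemma N_zero [simp]: "N 0 = 0"
  using N_scaleR[of 0 0] by simp

lemma N_nonneg [simp]: "0 \<le> N x"
  using N_pos[of x] by (cases "x = 0") auto

lemma N_minus [simp]: "N (- x) = N x"
  using N_scaleR[of "-1" x] by simp

lemma N_minus_commute: "N (x - y) = N (y - x)"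
  using N_minus[of "x - y"] by simp

lemma \<kappa>_pos: "\<kappa> > 0" using \<kappa>_ge_1 by linarith

lemma N_triangle_mono:
  assumes "N x \<le> a" "N y \<le> b"
  shows "N (x + y) \<le> \<kappa> * (a + b)"
proof -
  have "\<kappa> * (N x + N y) \<le> \<kappa> * (a + b)"
    using assms \<kappa>_pos by (intro mult_left_mono) auto
  with N_triangle[of x y] show ?thesis by linarith
qed

lemma N_triangle_less:
  assumes "N x < r / (2 * \<kappa>)" "N y < r / (2 * \<kappa>)"
  shows "N (x + y) < r"
proof -
  have "\<kappa> * (N x + N y) < \<kappa> * (r / (2 * \<kappa>) + r / (2 * \<kappa>))"
    using assms \<kappa>_pos by (intro mult_strict_left_mono) auto
  also have "\<dots> = r" using \<kappa>_pos by simp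
  finally show ?thesis using N_triangle[of x y] by linarith
qed

text \<open>Splitting off the first summand costs one factor \<kappa> each time, so the weights grow
  geometrically with the index. A series is later controlled by letting its terms decay faster than
  these weights grow.\<close>

lemma N_sum_le: "N (\<Sum>k<n. y k) \<le> (\<Sum>k<n. \<kappa> ^ Suc k * N (y k))"
proof (induction n arbitrary: y)
  case (Suc n)
  have "N (\<Sum>k<Suc n. y k) = N (y 0 + (\<Sum>k<n. y (Suc k)))"
    by (simp only: sum.lessThan_Suc_shift)
  also have "\<dots> \<le> \<kappa> * (N (y 0) + (\<Sum>k<n. \<kappa> ^ Suc k * N (y (Suc k))))"
    using Suc.IH by (intro N_triangle_mono) auto
  also have "\<dots> = (\<Sum>k<Suc n. \<kappa> ^ Suc k * N (y k))"
    by (simp only: sum.lessThan_Suc_shift) (simp add: sum_distrib_left algebra_simps)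
  finally show ?case .
qed simp

text \<open>Padding with zeros below m ties the weight to the absolute index k, so the tails of a
  series are measured with the same weights as the whole.\<close>

lemma N_sum_atLeastLessThan_le:
  "N (\<Sum>k=m..<n. y k) \<le> (\<Sum>k=m..<n. \<kappa> ^ Suc k * N (y k))"
proof -
  let ?z = "\<lambda>k. if m \<le> k then y k else 0"
  have *: "{k. k < n \<and> m \<le> k} = {m..<n}" by auto
  have "(\<Sum>k=m..<n. y k) = (\<Sum>k<n. ?z k)"
    by (simp add: sum.If_cases Int_def *)
  also have "N \<dots> \<le> (\<Sum>k<n. \<kappa> ^ Suc k * N (?z k))" by (rule N_sum_le)
  also have "\<dots> = (\<Sum>k<n. if m \<le> k then \<kappa> ^ Suc k * N (y k) else 0)"
    by (intro sum.cong) auto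
  also have "\<dots> = (\<Sum>k=m..<n. \<kappa> ^ Suc k * N (y k))"
    by (simp add: sum.If_cases Int_def *)
  finally show ?thesis .
qed

text \<open>The second summand absorbs the discontinuity of the quasi-norm in limits.\<close>

lemma N_le_of_approx:
  assumes "\<And>\<epsilon>. \<epsilon> > 0 \<Longrightarrow> \<exists>y. N (y - x) < \<epsilon> \<and> N y \<le> B"
  shows "N x \<le> \<kappa> * B"
proof (rule field_le_epsilon)
  fix e :: real assume "e > 0"
  then obtain y where y: "N (y - x) < e / \<kappa>" "N y \<le> B" using assms[of "e / \<kappa>"] \<kappa>_pos by auto
  have "N (y + (x - y)) \<le> \<kappa> * (B + e / \<kappa>)"
    using y by (intro N_triangle_mono) (auto simp: N_minus_commute)
  also have "\<dots> = \<kappa> * B + e" using \<kappa>_pos by (simp add: field_simps)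
  finally show "N x \<le> \<kappa> * B + e" by simp
qed

lemma N_eq_zero_of_approx:
  assumes "\<And>\<epsilon>. \<epsilon> > 0 \<Longrightarrow> N x < \<epsilon>"
  shows "x = 0"
  using assms N_pos by force

lemma has_riemann_integral_unique:
  assumes "has_riemann_integral N f L a b" "has_riemann_integral N f L' a b"
  shows "L = L'"
proof -
  have "N (L - L') < \<epsilon>" if "\<epsilon> > 0" for \<epsilon>
  proof -
    have e: "\<epsilon> / (2 * \<kappa>) > 0" using that \<kappa>_pos by simp
    obtain d where d: "d > 0" "\<And>p. p tagged_division_of {a..b} \<Longrightarrow> (\<And>x K. (x, K)\<in>p \<Longrightarrow> measure lborel K < d)
      \<Longrightarrow> N (riemann_sum f p - L) < \<epsilon> / (2 * \<kappa>)" using has_riemann_integralE[OF assms(1) e] by blast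
    obtain d' where d': "d' > 0" "\<And>p. p tagged_division_of {a..b} \<Longrightarrow> (\<And>x K. (x, K)\<in>p \<Longrightarrow> measure lborel K < d')
      \<Longrightarrow> N (riemann_sum f p - L') < \<epsilon> / (2 * \<kappa>)" using has_riemann_integralE[OF assms(2) e] by blast
    obtain p where p: "p tagged_division_of {a..b}" "\<And>x K. (x, K) \<in> p \<Longrightarrow> measure lborel K < min d d'"
      using fine_tagged_division_exists[of "min d d'" a b] d(1) d'(1) by auto
    have "N (riemann_sum f p - L) < \<epsilon> / (2 * \<kappa>)" "N (riemann_sum f p - L') < \<epsilon> / (2 * \<kappa>)"
      using p d(2)[of p] d'(2)[of p] by auto
    then have "N ((L - riemann_sum f p) + (riemann_sum f p - L')) < \<epsilon>"
      by (intro N_triangle_less) (auto simp: N_minus_commute)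
    then show ?thesis by simp
  qed
  then show ?thesis using N_eq_zero_of_approx[of "L - L'"] by simp
qed

lemma riemann_integral_eq:
  assumes "has_riemann_integral N f L a b"
  shows "riemann_integral N f a b = L"
  unfolding riemann_integral_def
  using assms has_riemann_integral_unique by (intro the_equality) auto

lemma has_riemann_integral_bound:
  assumes "has_riemann_integral N f L a b"
    and "\<And>p. p tagged_division_of {a..b} \<Longrightarrow> N (riemann_sum f p) \<le> B"
  shows "N L \<le> \<kappa> * B"
proof (rule N_le_of_approx)
  fix \<epsilon> :: real assume e: "\<epsilon> > 0"
  obtain d where d: "d > 0" "\<And>p. p tagged_division_of {a..b} \<Longrightarrow> (\<And>x K. (x, K)\<in>p \<Longrightarrow> measure lborel K < d)
      \<Longrightarrow> N (riemann_sum f p - L) < \<epsilon>" using has_riemann_integralE[OF assms(1) e] by blast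
  obtain p where p: "p tagged_division_of {a..b}" "\<And>x K. (x, K) \<in> p \<Longrightarrow> measure lborel K < d"
    using fine_tagged_division_exists[OF d(1)] by blast
  show "\<exists>y. N (y - L) < \<epsilon> \<and> N y \<le> B"
    using d(2)[of p] p assms(2)[OF p(1)] by blast
qed

lemma has_riemann_integral_zero: "has_riemann_integral N (\<lambda>u. 0) 0 a b"
  by (rule has_riemann_integralI) (auto simp: riemann_sum_zero intro: exI[of _ 1])

lemma has_riemann_integral_add:
  assumes "has_riemann_integral N f L a b" "has_riemann_integral N g L' a b"
  shows "has_riemann_integral N (\<lambda>u. f u + g u) (L + L') a b"
proof (rule has_riemann_integralI)
  fix \<epsilon> :: real assume "\<epsilon> > 0"
  then have e: "\<epsilon> / (2 * \<kappa>) > 0" using \<kappa>_pos by simp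
  obtain d where d: "d > 0" "\<And>p. p tagged_division_of {a..b} \<Longrightarrow> (\<And>x K. (x, K)\<in>p \<Longrightarrow> measure lborel K < d)
    \<Longrightarrow> N (riemann_sum f p - L) < \<epsilon> / (2 * \<kappa>)" using has_riemann_integralE[OF assms(1) e] by blast
  obtain d' where d': "d' > 0" "\<And>p. p tagged_division_of {a..b} \<Longrightarrow> (\<And>x K. (x, K)\<in>p \<Longrightarrow> measure lborel K < d')
    \<Longrightarrow> N (riemann_sum g p - L') < \<epsilon> / (2 * \<kappa>)" using has_riemann_integralE[OF assms(2) e] by blast
  have "N (riemann_sum (\<lambda>u. f u + g u) p - (L + L')) < \<epsilon>"
    if "p tagged_division_of {a..b}" "\<forall>(x, K)\<in>p. measure lborel K < min d d'" for p
  proof -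
    have "N ((riemann_sum f p - L) + (riemann_sum g p - L')) < \<epsilon>"
      using that by (intro N_triangle_less d(2) d'(2)) force+
    then show ?thesis by (simp add: riemann_sum_add algebra_simps)
  qed
  then show "\<exists>\<delta>>0. \<forall>p. p tagged_division_of {a..b} \<longrightarrow>
      (\<forall>(x, K)\<in>p. measure lborel K < \<delta>) \<longrightarrow> N (riemann_sum (\<lambda>u. f u + g u) p - (L + L')) < \<epsilon>"
    using d(1) d'(1) by (intro exI[of _ "min d d'"]) auto
qed

lemma has_riemann_integral_scaleR_const:
  assumes "has_riemann_integral abs \<phi> L a b"
  shows "has_riemann_integral N (\<lambda>u. \<phi> u *\<^sub>R x) (L *\<^sub>R x) a b"
proof (rule has_riemann_integralI)
  fix \<epsilon> :: real assume "\<epsilon> > 0"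
  then have e: "\<epsilon> / (N x + 1) > 0" by (simp add: add_nonneg_pos)
  obtain d where d: "d > 0" "\<And>p. p tagged_division_of {a..b} \<Longrightarrow> (\<And>x K. (x, K)\<in>p \<Longrightarrow> measure lborel K < d)
    \<Longrightarrow> \<bar>riemann_sum \<phi> p - L\<bar> < \<epsilon> / (N x + 1)" using has_riemann_integralE[OF assms(1) e] by blast
  have "N (riemann_sum (\<lambda>u. \<phi> u *\<^sub>R x) p - L *\<^sub>R x) < \<epsilon>"
    if "p tagged_division_of {a..b}" "\<forall>(x, K)\<in>p. measure lborel K < d" for p
  proof -
    have 1: "\<bar>riemann_sum \<phi> p - L\<bar> < \<epsilon> / (N x + 1)" using that by (intro d(2)) auto
    have "N (riemann_sum (\<lambda>u. \<phi> u *\<^sub>R x) p - L *\<^sub>R x) = \<bar>riemann_sum \<phi> p - L\<bar> * N x"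
      by (simp add: riemann_sum_scaleR_const N_scaleR flip: scaleR_diff_left)
    also have "\<dots> \<le> \<epsilon> / (N x + 1) * N x" using 1 by (intro mult_right_mono) auto
    also have "\<dots> < \<epsilon> / (N x + 1) * (N x + 1)" using e by (intro mult_strict_left_mono) auto
    also have "\<dots> = \<epsilon>" by (simp add: add_nonneg_eq_0_iff)
    finally show ?thesis .
  qed
  then show "\<exists>\<delta>>0. \<forall>p. p tagged_division_of {a..b} \<longrightarrow>
      (\<forall>(x, K)\<in>p. measure lborel K < \<delta>) \<longrightarrow> N (riemann_sum (\<lambda>u. \<phi> u *\<^sub>R x) p - L *\<^sub>R x) < \<epsilon>"
    using d(1) by blast
qed


section \<open>The induced topology and the convex hull of the unit ball\<close>

text \<open>A ball need not be open, so \<open>U\<close> is its interior: the points around which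
  some smaller ball still fits inside. Dividing the radius of that smaller ball by 2 \<kappa> leaves
  room for one use of the triangle inequality, which makes \<open>U\<close> open.\<close>

lemma ball_nhood:
  assumes "r > 0"
  obtains U where "openin (quasi_topology N) U" "x \<in> U" "\<And>y. y \<in> U \<Longrightarrow> N (y - x) < r"
proof -
  define U where "U = {z. \<exists>\<epsilon>>0. \<forall>y. N (y - z) < \<epsilon> \<longrightarrow> N (y - x) < r}"
  have "openin (quasi_topology N) U"
    unfolding openin_quasi_topology
  proof
    fix z assume "z \<in> U"
    then obtain \<epsilon> where \<epsilon>: "\<epsilon> > 0" "\<And>y. N (y - z) < \<epsilon> \<Longrightarrow> N (y - x) < r"
      unfolding U_def by blast
    have e: "\<epsilon> / (2 * \<kappa>) > 0" using \<epsilon> \<kappa>_pos by simp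
    have "w \<in> U" if w: "N (w - z) < \<epsilon> / (2 * \<kappa>)" for w
    proof -
      have "N (y - x) < r" if "N (y - w) < \<epsilon> / (2 * \<kappa>)" for y
      proof -
        have "N ((y - w) + (w - z)) < \<epsilon>" using that w by (rule N_triangle_less)
        then show ?thesis by (intro \<epsilon>(2)) simp
      qed
      with e show ?thesis unfolding U_def by blast
    qed
    with e show "\<exists>\<epsilon>>0. \<forall>w. N (w - z) < \<epsilon> \<longrightarrow> w \<in> U" by blast
  qed
  moreover have "x \<in> U" using assms unfolding U_def by blast
  moreover have "N (y - x) < r" if "y \<in> U" for y
  proof -
    from that obtain \<epsilon> where "\<epsilon> > 0" "\<forall>w. N (w - y) < \<epsilon> \<longrightarrow> N (w - x) < r" unfolding U_def by blast
    then show ?thesis by (metis N_zero diff_self)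
  qed
  ultimately show ?thesis by (rule that)
qed

lemma limitin_quasi_topologyI:
  assumes "\<And>\<epsilon>. \<epsilon> > 0 \<Longrightarrow> eventually (\<lambda>z. N (g z - l) < \<epsilon>) F"
  shows "limitin (quasi_topology N) g l F"
  unfolding limitin_def
proof (intro conjI allI impI)
  fix U assume "openin (quasi_topology N) U \<and> l \<in> U"
  then obtain \<epsilon> where "\<epsilon> > 0" "\<And>y. N (y - l) < \<epsilon> \<Longrightarrow> y \<in> U"
    unfolding openin_quasi_topology by blast
  with assms[of \<epsilon>] show "eventually (\<lambda>z. g z \<in> U) F" by (auto elim: eventually_mono)
qed simp

text \<open>The contrapositive is how the failure of local convexity enters: the hull of the unit
  ball then contains vectors of arbitrarily large quasi-norm. If the hull is bounded, its shrunk and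
  translated copies are arbitrarily small convex neighbourhoods.\<close>

lemma locally_convexI:
  assumes "\<And>y. y \<in> convex hull {x. N x \<le> 1} \<Longrightarrow> N y \<le> C"
  shows "locally_convex (quasi_topology N)"
  unfolding neighbourhood_base_of
proof (intro allI impI)
  fix W x assume "openin (quasi_topology N) W \<and> x \<in> W"
  then obtain \<epsilon> where \<epsilon>: "\<epsilon> > 0" "\<And>y. N (y - x) < \<epsilon> \<Longrightarrow> y \<in> W"
    unfolding openin_quasi_topology by blast
  \<comment> \<open>Shrinking the hull by \<theta> leaves vectors of quasi-norm at most \<theta> |C|
    < \<epsilon>; \<theta> is positive whatever the sign of C.\<close>
  define \<theta> where "\<theta> = \<epsilon> / (\<bar>C\<bar> + 1)"
  have \<theta>: "\<theta> > 0" unfolding \<theta>_def using \<epsilon>(1) by (simp add: add_nonneg_pos)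
  define V where "V = (+) x ` ((*\<^sub>R) \<theta> ` (convex hull {x. N x \<le> 1}))"
  obtain U where U: "openin (quasi_topology N) U" "x \<in> U" "\<And>y. y \<in> U \<Longrightarrow> N (y - x) < \<theta>"
    using ball_nhood[OF \<theta>, of x] by blast
  have "convex V"
    unfolding V_def by (intro convex_translation convex_scaling convex_convex_hull)
  moreover have "U \<subseteq> V"
  proof
    fix y assume "y \<in> U"
    then have "N ((1 / \<theta>) *\<^sub>R (y - x)) \<le> 1"
      using U(3)[of y] \<theta> by (simp add: N_scaleR)
    then have "(1 / \<theta>) *\<^sub>R (y - x) \<in> convex hull {x. N x \<le> 1}"
      by (simp add: hull_inc)
    moreover have "y = x + \<theta> *\<^sub>R ((1 / \<theta>) *\<^sub>R (y - x))" using \<theta> by simp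
    ultimately show "y \<in> V" unfolding V_def by blast
  qed
  moreover have "V \<subseteq> W"
  proof
    fix z assume "z \<in> V"
    then obtain y where y: "z = x + \<theta> *\<^sub>R y" "N y \<le> C" unfolding V_def using assms by blast
    have "N (z - x) = \<theta> * N y" using \<theta> y by (simp add: N_scaleR)
    also have "\<dots> \<le> \<theta> * \<bar>C\<bar>" using \<theta> y(2) by (intro mult_left_mono) auto
    also have "\<dots> < \<theta> * (\<bar>C\<bar> + 1)" using \<theta> by simp
    also have "\<dots> = \<epsilon>" unfolding \<theta>_def by (simp add: add_nonneg_eq_0_iff)
    finally show "z \<in> W" by (rule \<epsilon>(2))
  qed
  ultimately show "\<exists>U V. openin (quasi_topology N) U \<and> convex V \<and> x \<in> U \<and> U \<subseteq> V \<and> V \<subseteq> W"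
    using U by blast
qed

section \<open>Functions with a differentiable integral\<close>

text \<open>In a space that is not locally convex, continuity guarantees neither integrability nor
  differentiability of the integral, so all three are carried along together. The estimate with the
  factor |t - c| is differentiability of \<open>P\<close> at c with derivative \<open>h c\<close>,
  stated through \<open>N\<close> because the type has no norm.\<close>

definition C1_primitive :: "(real \<Rightarrow> 'a) \<Rightarrow> (real \<Rightarrow> 'a) \<Rightarrow> bool" where
  "C1_primitive h P \<longleftrightarrow> P 0 = 0 \<and>
     (\<forall>c\<in>{0..1}. \<forall>\<epsilon>>0. \<exists>\<delta>>0. \<forall>u\<in>{0..1}. \<bar>u - c\<bar> < \<delta> \<longrightarrow> N (h u - h c) < \<epsilon>) \<and>
     (\<forall>c\<in>{0..1}. \<forall>\<epsilon>>0. \<exists>\<delta>>0. \<forall>t\<in>{0..1}. \<bar>t - c\<bar> < \<delta> \<longrightarrow>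
        N (P t - P c - (t - c) *\<^sub>R h c) \<le> \<epsilon> * \<bar>t - c\<bar>) \<and>
     (\<forall>s t. 0 \<le> s \<longrightarrow> s \<le> t \<longrightarrow> t \<le> 1 \<longrightarrow> has_riemann_integral N h (P t - P s) s t)"

lemma C1_primitiveD:
  assumes "C1_primitive h P"
  shows "P 0 = 0"
    and "\<And>c \<epsilon>. c \<in> {0..1} \<Longrightarrow> \<epsilon> > 0 \<Longrightarrow>
      \<exists>\<delta>>0. \<forall>u\<in>{0..1}. \<bar>u - c\<bar> < \<delta> \<longrightarrow> N (h u - h c) < \<epsilon>"
    and "\<And>c \<epsilon>. c \<in> {0..1} \<Longrightarrow> \<epsilon> > 0 \<Longrightarrow> \<exists>\<delta>>0. \<forall>t\<in>{0..1}. \<bar>t - c\<bar> < \<delta> \<longrightarrow>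
      N (P t - P c - (t - c) *\<^sub>R h c) \<le> \<epsilon> * \<bar>t - c\<bar>"
    and "\<And>s t. 0 \<le> s \<Longrightarrow> s \<le> t \<Longrightarrow> t \<le> 1 \<Longrightarrow> has_riemann_integral N h (P t - P s) s t"
  using assms unfolding C1_primitive_def by blast+

lemma C1_primitive_zero: "C1_primitive (\<lambda>u. 0) (\<lambda>t. 0)"
  unfolding C1_primitive_def by (auto simp: has_riemann_integral_zero intro: exI[of _ "1::real"])

lemma C1_primitive_add:
  assumes "C1_primitive f F" "C1_primitive g G"
  shows "C1_primitive (\<lambda>u. f u + g u) (\<lambda>u. F u + G u)"
  unfolding C1_primitive_def
proof (intro conjI ballI allI impI)
  show "F 0 + G 0 = 0" using assms[THEN C1_primitiveD(1)] by simp
next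
  fix c \<epsilon> :: real assume c: "c \<in> {0..1}" and "\<epsilon> > 0"
  then have e: "\<epsilon> / (2 * \<kappa>) > 0" using \<kappa>_pos by simp
  obtain d where d: "d > 0" "\<And>u. u \<in> {0..1} \<Longrightarrow> \<bar>u - c\<bar> < d \<Longrightarrow> N (f u - f c) < \<epsilon> / (2 * \<kappa>)"
    using C1_primitiveD(2)[OF assms(1) c e] by blast
  obtain d' where d': "d' > 0" "\<And>u. u \<in> {0..1} \<Longrightarrow> \<bar>u - c\<bar> < d' \<Longrightarrow> N (g u - g c) < \<epsilon> / (2 * \<kappa>)"
    using C1_primitiveD(2)[OF assms(2) c e] by blast
  have "N (f u + g u - (f c + g c)) < \<epsilon>" if "u \<in> {0..1}" "\<bar>u - c\<bar> < min d d'" for u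
  proof -
    have "N ((f u - f c) + (g u - g c)) < \<epsilon>"
      using that by (intro N_triangle_less d(2) d'(2)) auto
    then show ?thesis by (simp add: algebra_simps)
  qed
  then show "\<exists>\<delta>>0. \<forall>u\<in>{0..1}. \<bar>u - c\<bar> < \<delta> \<longrightarrow> N (f u + g u - (f c + g c)) < \<epsilon>"
    using d(1) d'(1) by (intro exI[of _ "min d d'"]) auto
next
  fix c \<epsilon> :: real assume c: "c \<in> {0..1}" and "\<epsilon> > 0"
  then have e: "\<epsilon> / (2 * \<kappa>) > 0" using \<kappa>_pos by simp
  obtain d where d: "d > 0" "\<And>t. t \<in> {0..1} \<Longrightarrow> \<bar>t - c\<bar> < d \<Longrightarrow>
      N (F t - F c - (t - c) *\<^sub>R f c) \<le> \<epsilon> / (2 * \<kappa>) * \<bar>t - c\<bar>"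
    using C1_primitiveD(3)[OF assms(1) c e] by blast
  obtain d' where d': "d' > 0" "\<And>t. t \<in> {0..1} \<Longrightarrow> \<bar>t - c\<bar> < d' \<Longrightarrow>
      N (G t - G c - (t - c) *\<^sub>R g c) \<le> \<epsilon> / (2 * \<kappa>) * \<bar>t - c\<bar>"
    using C1_primitiveD(3)[OF assms(2) c e] by blast
  have "N (F t + G t - (F c + G c) - (t - c) *\<^sub>R (f c + g c)) \<le> \<epsilon> * \<bar>t - c\<bar>"
    if "t \<in> {0..1}" "\<bar>t - c\<bar> < min d d'" for t
  proof -
    have "N ((F t - F c - (t - c) *\<^sub>R f c) + (G t - G c - (t - c) *\<^sub>R g c))
        \<le> \<kappa> * (\<epsilon> / (2 * \<kappa>) * \<bar>t - c\<bar> + \<epsilon> / (2 * \<kappa>) * \<bar>t - c\<bar>)"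
      using that by (intro N_triangle_mono d(2) d'(2)) auto
    also have "\<dots> = \<epsilon> * \<bar>t - c\<bar>" using \<kappa>_pos by (simp add: field_simps)
    finally show ?thesis by (simp add: algebra_simps)
  qed
  then show "\<exists>\<delta>>0. \<forall>t\<in>{0..1}. \<bar>t - c\<bar> < \<delta> \<longrightarrow>
      N (F t + G t - (F c + G c) - (t - c) *\<^sub>R (f c + g c)) \<le> \<epsilon> * \<bar>t - c\<bar>"
    using d(1) d'(1) by (intro exI[of _ "min d d'"]) auto
next
  fix s t :: real assume "0 \<le> s" "s \<le> t" "t \<le> 1"
  then have "has_riemann_integral N (\<lambda>u. f u + g u) ((F t - F s) + (G t - G s)) s t"
    using assms by (intro has_riemann_integral_add C1_primitiveD(4))
  then show "has_riemann_integral N (\<lambda>u. f u + g u) (F t + G t - (F s + G s)) s t"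
    by (simp add: algebra_simps)
qed

lemma C1_primitive_sum:
  assumes "\<And>j. j < (n::nat) \<Longrightarrow> C1_primitive (f j) (F j)"
  shows "C1_primitive (\<lambda>u. \<Sum>j<n. f j u) (\<lambda>u. \<Sum>j<n. F j u)"
  using assms
  by (induction n) (simp_all add: C1_primitive_zero C1_primitive_add)

text \<open>On the line spanned by x the quasi-norm is a multiple of the absolute value, so real
  calculus transfers with errors multiplied by \<open>N x\<close>. Together with finite sums this
  covers every block.\<close>

lemma C1_primitive_scaleR_const:
  fixes \<phi> :: "real \<Rightarrow> real"
  assumes "continuous_on {0..1} \<phi>"
  shows "C1_primitive (\<lambda>u. \<phi> u *\<^sub>R x) (\<lambda>t. integral {0..t} \<phi> *\<^sub>R x)"
  unfolding C1_primitive_def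
proof (intro conjI ballI allI impI)
  show "integral {0..0} \<phi> *\<^sub>R x = 0" by simp
next
  fix c \<epsilon> :: real assume c: "c \<in> {0..1}" and "\<epsilon> > 0"
  then have e: "\<epsilon> / (N x + 1) > 0" by (simp add: add_nonneg_pos)
  with assms c obtain d where d: "d > 0" "\<And>u. u \<in> {0..1} \<Longrightarrow> \<bar>u - c\<bar> < d \<Longrightarrow> \<bar>\<phi> u - \<phi> c\<bar> < \<epsilon> / (N x + 1)"
    unfolding continuous_on_iff dist_real_def by metis
  have "N (\<phi> u *\<^sub>R x - \<phi> c *\<^sub>R x) < \<epsilon>" if "u \<in> {0..1}" "\<bar>u - c\<bar> < d" for u
  proof -
    have "N (\<phi> u *\<^sub>R x - \<phi> c *\<^sub>R x) = \<bar>\<phi> u - \<phi> c\<bar> * N x"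
      by (simp add: N_scaleR flip: scaleR_diff_left)
    also have "\<dots> \<le> \<epsilon> / (N x + 1) * N x" using d(2)[OF that] by (intro mult_right_mono) auto
    also have "\<dots> < \<epsilon> / (N x + 1) * (N x + 1)" using e by (intro mult_strict_left_mono) auto
    also have "\<dots> = \<epsilon>" by (simp add: add_nonneg_eq_0_iff)
    finally show ?thesis .
  qed
  then show "\<exists>\<delta>>0. \<forall>u\<in>{0..1}. \<bar>u - c\<bar> < \<delta> \<longrightarrow> N (\<phi> u *\<^sub>R x - \<phi> c *\<^sub>R x) < \<epsilon>"
    using d(1) by blast
next
  fix c \<epsilon> :: real assume c: "c \<in> {0..1}" and "\<epsilon> > 0"
  then have e: "\<epsilon> / (N x + 1) > 0" by (simp add: add_nonneg_pos)
  have "((\<lambda>t. integral {0..t} \<phi>) has_derivative (\<lambda>h. h * \<phi> c)) (at c within {0..1})"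
    using integral_has_vector_derivative[OF assms c] by (simp add: has_vector_derivative_def)
  then obtain d where d: "d > 0" "\<And>t. t \<in> {0..1} \<Longrightarrow> \<bar>t - c\<bar> < d \<Longrightarrow>
      \<bar>integral {0..t} \<phi> - integral {0..c} \<phi> - (t - c) * \<phi> c\<bar> \<le> \<epsilon> / (N x + 1) * \<bar>t - c\<bar>"
    using e unfolding has_derivative_within_alt real_norm_def by meson
  have "N (integral {0..t} \<phi> *\<^sub>R x - integral {0..c} \<phi> *\<^sub>R x - (t - c) *\<^sub>R \<phi> c *\<^sub>R x) \<le> \<epsilon> * \<bar>t - c\<bar>"
    if "t \<in> {0..1}" "\<bar>t - c\<bar> < d" for t
  proof -
    have "integral {0..t} \<phi> *\<^sub>R x - integral {0..c} \<phi> *\<^sub>R x - (t - c) *\<^sub>R \<phi> c *\<^sub>R x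
       = (integral {0..t} \<phi> - integral {0..c} \<phi> - (t - c) * \<phi> c) *\<^sub>R x"
      by (simp add: scaleR_diff_left)
    then have "N (integral {0..t} \<phi> *\<^sub>R x - integral {0..c} \<phi> *\<^sub>R x - (t - c) *\<^sub>R \<phi> c *\<^sub>R x)
       = \<bar>integral {0..t} \<phi> - integral {0..c} \<phi> - (t - c) * \<phi> c\<bar> * N x"
      by (simp only: N_scaleR)
    also have "\<dots> \<le> (\<epsilon> / (N x + 1) * \<bar>t - c\<bar>) * (N x + 1)"
      using d(2)[OF that] e by (intro mult_mono) auto
    also have "\<dots> = \<epsilon> * \<bar>t - c\<bar>" by (simp add: add_nonneg_eq_0_iff)
    finally show ?thesis .
  qed
  then show "\<exists>\<delta>>0. \<forall>t\<in>{0..1}. \<bar>t - c\<bar> < \<delta> \<longrightarrow>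
      N (integral {0..t} \<phi> *\<^sub>R x - integral {0..c} \<phi> *\<^sub>R x - (t - c) *\<^sub>R \<phi> c *\<^sub>R x) \<le> \<epsilon> * \<bar>t - c\<bar>"
    using d(1) by blast
next
  fix s t :: real assume st: "0 \<le> s" "s \<le> t" "t \<le> 1"
  have "integral {0..s} \<phi> + integral {s..t} \<phi> = integral {0..t} \<phi>"
    using st assms by (intro Henstock_Kurzweil_Integration.integral_combine)
      (auto intro!: integrable_continuous_interval elim: continuous_on_subset)
  then have "integral {0..t} \<phi> *\<^sub>R x - integral {0..s} \<phi> *\<^sub>R x = integral {s..t} \<phi> *\<^sub>R x"
    by (simp flip: scaleR_diff_left)
  moreover have "has_riemann_integral N (\<lambda>u. \<phi> u *\<^sub>R x) (integral {s..t} \<phi> *\<^sub>R x) s t"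
    using st assms by (intro has_riemann_integral_scaleR_const continuous_has_riemann_integral)
      (auto elim: continuous_on_subset)
  ultimately show "has_riemann_integral N (\<lambda>u. \<phi> u *\<^sub>R x)
      (integral {0..t} \<phi> *\<^sub>R x - integral {0..s} \<phi> *\<^sub>R x) s t" by simp
qed

section \<open>Locality of integrals and the construction of one block\<close>

text \<open>Comparison with the zero function shows that a primitive is constant off the support;
  comparison with a block or a partial sum identifies increments of the primitive of the whole
  series.\<close>

lemma has_riemann_integral_eq_on:
  assumes "has_riemann_integral N f L s t" "has_riemann_integral N g L' s t"
    and "\<And>u. u \<in> {s..t} \<Longrightarrow> f u = g u"
  shows "L = L'"
  using has_riemann_integral_unique[OF has_riemann_integral_cong[OF assms(1,3)] assms(2)] by blast

text \<open>Intervals of the division inside \<open>{a..b}\<close> are controlled by \<open>D\<close>; at most two others carry a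
  tag in the support, namely those containing \<open>a\<close> or \<open>b\<close> in their interior. The bound holds for
  arbitrarily coarse divisions, so the Riemann sums of a series of blocks converge uniformly in
  the division.\<close>

lemma riemann_sum_localized:
  assumes p: "p tagged_division_of {s..t}" and st: "t - s \<le> 1" and ab: "a \<le> b" and D: "0 \<le> D"
    and supp: "\<And>u. u \<notin> {a<..<b} \<Longrightarrow> h u = 0"
    and small: "\<And>u. N (h u) \<le> e"
    and bound: "\<And>A. finite A \<Longrightarrow> N (riemann_sum h A) \<le> D * (\<Sum>(x, K)\<in>A. measure lborel K)"
  shows "N (riemann_sum h p) \<le> \<kappa> * (D * (b - a) + \<kappa> * (e + e))"
proof -
  note pD = tagged_division_ofD[OF p]
  have e: "0 \<le> e" using small[of 0] N_nonneg[of "h 0"] by linarith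
  have K_int: "\<exists>c d. K = {c..d} \<and> c \<le> x \<and> x \<le> d \<and> s \<le> c \<and> d \<le> t" if xK: "(x, K) \<in> p" for x K
  proof -
    obtain c d where "K = cbox c d" using pD(4)[OF xK] by blast
    with pD(2,3)[OF xK] show ?thesis by auto
  qed
  \<comment> \<open>The interiors of the intervals are pairwise disjoint, so at most one of them
    contains c, and its length is at most 1. The parameter \<open>Q\<close> lets the pieces for a
    and b be made disjoint.\<close>
  have single: "N (riemann_sum h {z\<in>p. c \<in> interior (snd z) \<and> Q z}) \<le> e" (is "N (riemann_sum h ?A) \<le> e")
    for c Q
  proof (cases "?A = {}")
    case True
    show ?thesis unfolding riemann_sum_def True using e by simp
  next
    case False
    then obtain x K where z: "(x, K) \<in> ?A" by auto
    have "z' = (x, K)" if "z' \<in> ?A" for z'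
      using pD(5)[of x K "fst z'" "snd z'"] z that by (cases z') auto
    then have "?A = {(x, K)}" using z by blast
    then have "riemann_sum h ?A = measure lborel K *\<^sub>R h x"
      unfolding riemann_sum_def by simp
    moreover have "measure lborel K \<le> 1" using K_int[of x K] z st by auto
    then have "measure lborel K * N (h x) \<le> 1 * e"
      using small[of x] by (intro mult_mono) auto
    ultimately show ?thesis by (simp add: N_scaleR)
  qed
  \<comment> \<open>An interval with both a and b in its interior is counted in \<open>A\<close>
    only. The conjunct \<open>True\<close> gives \<open>A\<close> the shape of
    \<open>single\<close>.\<close>
  define A where "A = {z\<in>p. a \<in> interior (snd z) \<and> True}"
  define B where "B = {z\<in>p. b \<in> interior (snd z) \<and> a \<notin> interior (snd z)}"
  define C where "C = {z\<in>p. a \<notin> interior (snd z) \<and> b \<notin> interior (snd z) \<and> h (fst z) \<noteq> 0}"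
  have fin: "finite A" "finite B" "finite C"
    unfolding A_def B_def C_def using pD(1) by auto
  have "riemann_sum h p = riemann_sum h (C \<union> (A \<union> B))"
    unfolding riemann_sum_def using pD(1)
    by (intro sum.mono_neutral_right) (auto simp: A_def B_def C_def)
  also have "\<dots> = riemann_sum h C + riemann_sum h (A \<union> B)"
    unfolding riemann_sum_def using fin by (intro sum.union_disjoint) (auto simp: A_def B_def C_def)
  also have "riemann_sum h (A \<union> B) = riemann_sum h A + riemann_sum h B"
    unfolding riemann_sum_def using fin by (intro sum.union_disjoint) (auto simp: A_def B_def)
  finally have eq: "riemann_sum h p = riemann_sum h C + (riemann_sum h A + riemann_sum h B)" .
  have "C tagged_partial_division_of {s..t}"
    using p unfolding tagged_division_of_def
    by (auto intro: tagged_partial_division_subset simp: C_def)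
  then have C: "C tagged_division_of \<Union>(snd ` C)" "snd ` C division_of \<Union>(snd ` C)"
    by (rule tagged_partial_division_of_Union_self, rule partial_division_of_tagged_division)
  \<comment> \<open>An interval that contains a point strictly between a and b, but neither of them
    in its interior, cannot reach beyond them.\<close>
  have "K \<subseteq> {a..b}" if "(x, K) \<in> C" for x K
  proof -
    from that have xK: "(x, K) \<in> p" "a \<notin> interior K" "b \<notin> interior K" "x \<in> {a<..<b}"
      using supp unfolding C_def by auto
    with K_int[OF xK(1)] show ?thesis by auto
  qed
  then have "\<Union>(snd ` C) \<subseteq> cbox a b" by fastforce
  then have "(\<Sum>K\<in>snd ` C. measure lborel K) \<le> measure lborel (cbox a b)"
    by (rule subadditive_content_division[OF C(2)])
  moreover have "(\<Sum>(x, K)\<in>C. measure lborel K) = (\<Sum>K\<in>snd ` C. measure lborel K)"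
    by (rule sum.over_tagged_division_lemma[OF C(1)]) (simp add: content_eq_0_interior)
  ultimately have "(\<Sum>(x, K)\<in>C. measure lborel K) \<le> b - a" using ab by simp
  then have "N (riemann_sum h C) \<le> D * (b - a)"
    using bound[OF fin(3)] mult_left_mono[OF _ D] by fastforce
  then show ?thesis
    unfolding eq A_def B_def by (intro N_triangle_mono single)
qed

text \<open>The constant \<open>D\<close> of the proof bounds the Riemann sums relative to length. It depends only on the
  vectors of the convex combination, not on the length \<open>d\<close> of the interval used, so \<open>d\<close> may be
  chosen after it.\<close>

lemma block_exists:
  assumes unb: "\<And>C. \<exists>y\<in>convex hull {x. N x \<le> 1}. C < N y"
    and \<epsilon>: "\<epsilon> > 0" and ab: "0 \<le> a" "a < b" "b \<le> 1"
  shows "\<exists>h P. C1_primitive h P \<and> (\<forall>u. u \<notin> {a<..<b} \<longrightarrow> h u = 0) \<and> (\<forall>u. N (h u) \<le> \<epsilon>) \<and>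
    (\<forall>p s t. p tagged_division_of {s..t} \<longrightarrow> t - s \<le> 1 \<longrightarrow> N (riemann_sum h p) \<le> \<epsilon>) \<and>
    (\<forall>s\<in>{0..1}. \<forall>t\<in>{0..1}. N (P t - P s) \<le> \<bar>t - s\<bar>) \<and>
    (\<exists>s t. a \<le> s \<and> s < t \<and> t \<le> b \<and> (t - s) / 2 \<le> N (P t - P s))"
proof -
  \<comment> \<open>The estimate of \<open>riemann_sum_localized\<close> becomes \<kappa> (e +
    \<kappa> (e + e)), at most 3 \<kappa>^2 e. The bound e \<le> 1 makes the normalising factor
    \<open>M\<close> at least 1.\<close>
  define e where "e = min 1 (\<epsilon> / (3 * \<kappa>^2))"
  have e: "0 < e" "e \<le> 1" "3 * \<kappa>^2 * e \<le> \<epsilon>"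
    using \<epsilon> \<kappa>_pos unfolding e_def by (auto simp: min_def field_simps)
  \<comment> \<open>Each bump integrates to 1/6 of the length of its interval, so the average over
    the whole block is y / 6; the threshold 6 / e makes its quasi-norm exceed 1 / e.\<close>
  obtain y where y: "y \<in> convex hull {x. N x \<le> 1}" "6 / e < N y" using unb by blast
  then obtain k u x where ux: "\<And>i. i \<in> {1::nat..k} \<Longrightarrow> 0 \<le> u i \<and> N (x i) \<le> 1"
    "sum u {1..k} = 1" "(\<Sum>i=1..k. u i *\<^sub>R x i) = y"
    unfolding convex_hull_indexed by blast
  define l where "l i = u (Suc i)" for i
  define z where "z i = x (Suc i)" for i
  have lz: "\<And>i. i < k \<Longrightarrow> 0 \<le> l i" "\<And>i. i < k \<Longrightarrow> N (z i) \<le> 1"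
    "(\<Sum>i<k. l i) = 1" "(\<Sum>i<k. l i *\<^sub>R z i) = y"
    using ux by (auto simp: l_def z_def sum.atLeast1_atMost_eq)
  define D where "D = (\<Sum>j<k. \<kappa> ^ Suc j * N (z j))"
  have D: "0 \<le> D" unfolding D_def using \<kappa>_pos by (intro sum_nonneg) auto
  \<comment> \<open>With D d \<le> e, the intervals inside the support add at most e to a Riemann
    sum, up to a factor \<kappa>.\<close>
  define d where "d = min (b - a) (e / (D + 1))"
  have d: "0 < d" "a + d \<le> b" "D * d \<le> e"
  proof -
    show "0 < d" "a + d \<le> b" unfolding d_def using ab e D by auto
    have "D * d \<le> (D + 1) * (e / (D + 1))"
      unfolding d_def using D e ab by (intro mult_mono) auto
    then show "D * d \<le> e" using D by simp
  qed
  define c where "c j = a + d * (\<Sum>i<j. l i)" for j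
  have c_Suc: "c (Suc j) = c j + d * l j" for j by (simp add: c_def algebra_simps)
  have c_mono: "c i \<le> c j" if "i \<le> j" "j \<le> k" for i j
  proof -
    have "(\<Sum>i<i. l i) \<le> (\<Sum>i<j. l i)" using that lz(1) by (intro sum_mono2) auto
    then show ?thesis using d(1) by (simp add: c_def)
  qed
  have c_k: "c k = a + d" using lz(3) by (simp add: c_def)
  have c_0: "c 0 = a" by (simp add: c_def)
  have "\<forall>j\<in>{..<k}. \<exists>\<phi>. continuous_on {0..1} \<phi> \<and> (\<forall>u. 0 \<le> \<phi> u \<and> \<phi> u \<le> 1) \<and>
      (\<forall>u. u \<notin> {c j<..<c (Suc j)} \<longrightarrow> \<phi> u = 0) \<and> integral {0..1} \<phi> = d * l j / 6"
  proof
    fix j assume j: "j \<in> {..<k}"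
    then have "a \<le> c j" "c j + d * l j \<le> a + d"
      using c_mono[of 0 j] c_mono[of "Suc j" k] by (auto simp: c_Suc c_k c_0)
    then show "\<exists>\<phi>. continuous_on {0..1} \<phi> \<and> (\<forall>u. 0 \<le> \<phi> u \<and> \<phi> u \<le> 1) \<and>
      (\<forall>u. u \<notin> {c j<..<c (Suc j)} \<longrightarrow> \<phi> u = 0) \<and> integral {0..1} \<phi> = d * l j / 6"
      unfolding c_Suc using ab d lz(1) j by (intro bump_exists) auto
  qed
  from bchoice[OF this] obtain \<phi> where "\<forall>j\<in>{..<k}. continuous_on {0..1} (\<phi> j) \<and>
      (\<forall>u. 0 \<le> \<phi> j u \<and> \<phi> j u \<le> (1::real)) \<and>
      (\<forall>u. u \<notin> {c j<..<c (Suc j)} \<longrightarrow> \<phi> j u = 0) \<and> integral {0..1} (\<phi> j) = d * l j / 6" ..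
  then have \<phi>_cont: "continuous_on {0..1} (\<phi> j)"
    and \<phi>_01: "0 \<le> \<phi> j u \<and> \<phi> j u \<le> 1" and \<phi>_supp: "u \<notin> {c j<..<c (Suc j)} \<Longrightarrow> \<phi> j u = 0"
    and \<phi>_int: "integral {0..1} (\<phi> j) = d * l j / 6"
    if "j < k" for j u using that by auto
  define h where "h u = (\<Sum>j<k. \<phi> j u *\<^sub>R z j)" for u
  define P where "P t = (\<Sum>j<k. integral {0..t} (\<phi> j) *\<^sub>R z j)" for t
  have h_supp: "h u = 0" if "u \<notin> {a<..<a + d}" for u
    unfolding h_def
  proof (rule sum.neutral, rule ballI)
    fix j assume j: "j \<in> {..<k}"
    then have "a \<le> c j" "c (Suc j) \<le> a + d"
      using c_mono[of 0 j] c_mono[of "Suc j" k] by (auto simp: c_k c_0)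
    with that j have "\<phi> j u = 0" by (intro \<phi>_supp) auto
    then show "\<phi> j u *\<^sub>R z j = 0" by simp
  qed
  \<comment> \<open>The bumps live on disjoint open intervals, so at each point at most one term
    survives and no factor \<kappa> is lost.\<close>
  have h_le: "N (h u) \<le> 1" for u
  proof (cases "\<exists>j<k. \<phi> j u \<noteq> 0")
    case True
    then obtain j where j: "j < k" "\<phi> j u \<noteq> 0" by blast
    have uj: "c i < u" "u < c (Suc i)" if "i < k" "\<phi> i u \<noteq> 0" for i
      using \<phi>_supp[of i u] that by auto
    have "\<phi> i u = 0" if i: "i < k" "i \<noteq> j" for i
    proof (rule ccontr)
      assume "\<phi> i u \<noteq> 0"
      with i j uj[of i] uj[of j] c_mono[of "Suc i" j] c_mono[of "Suc j" i] show False
        by (cases i j rule: linorder_cases) auto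
    qed
    then have "h u = (\<Sum>i\<in>{j}. \<phi> i u *\<^sub>R z i)"
      unfolding h_def using j by (intro sum.mono_neutral_right) auto
    then have "N (h u) = \<phi> j u * N (z j)" using \<phi>_01[OF j(1)] by (simp add: N_scaleR)
    also have "\<dots> \<le> 1 * 1" using \<phi>_01[OF j(1)] lz(2)[OF j(1)] by (intro mult_mono) auto
    finally show ?thesis by simp
  qed (auto simp: h_def)
  have h_sum: "N (riemann_sum h A) \<le> D * (\<Sum>(x, K)\<in>A. measure lborel K)" for A
  proof -
    have "riemann_sum h A = (\<Sum>j<k. riemann_sum (\<phi> j) A *\<^sub>R z j)"
      unfolding h_def riemann_sum_sum riemann_sum_scaleR_const ..
    also have "N \<dots> \<le> (\<Sum>j<k. \<kappa> ^ Suc j * N (riemann_sum (\<phi> j) A *\<^sub>R z j))" by (rule N_sum_le)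
    also have "\<dots> \<le> (\<Sum>j<k. (\<kappa> ^ Suc j * N (z j)) * (\<Sum>(x, K)\<in>A. measure lborel K))"
    proof (rule sum_mono)
      fix j assume "j \<in> {..<k}"
      then have "\<bar>riemann_sum (\<phi> j) A\<bar> \<le> (\<Sum>(x, K)\<in>A. measure lborel K)"
        unfolding riemann_sum_def using \<phi>_01
        by (intro order_trans[OF sum_abs] sum_mono) (auto simp: abs_mult mult_left_le)
      then have "(\<kappa> ^ Suc j * N (z j)) * \<bar>riemann_sum (\<phi> j) A\<bar> \<le> 
          (\<kappa> ^ Suc j * N (z j)) * (\<Sum>(x, K)\<in>A. measure lborel K)"
        using \<kappa>_pos by (intro mult_left_mono) auto
      then show "\<kappa> ^ Suc j * N (riemann_sum (\<phi> j) A *\<^sub>R z j)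
          \<le> (\<kappa> ^ Suc j * N (z j)) * (\<Sum>(x, K)\<in>A. measure lborel K)"
        by (simp add: N_scaleR mult_ac)
    qed
    also have "\<dots> = D * (\<Sum>(x, K)\<in>A. measure lborel K)" by (simp add: D_def sum_distrib_right)
    finally show ?thesis .
  qed
  have hP: "C1_primitive h P"
    unfolding h_def P_def by (intro C1_primitive_sum C1_primitive_scaleR_const \<phi>_cont)
  \<comment> \<open>A crude Lipschitz bound that makes the set \<open>S\<close> of quasi-norms of
    averages bounded; the sharp constant is its supremum \<open>M\<close>.\<close>
  have P_Lip: "N (P t - P s) \<le> \<kappa> * D * (t - s)" if st: "0 \<le> s" "s \<le> t" "t \<le> 1" for s t
  proof -
    have "N (riemann_sum h p) \<le> D * (t - s)" if "p tagged_division_of {s..t}" for p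
      using h_sum[of p] additive_content_tagged_division[of p s t] that st by simp
    with has_riemann_integral_bound[OF C1_primitiveD(4)[OF hP st]] show ?thesis by (simp add: mult.assoc)
  qed
  have P_const: "P s = P t" if st: "0 \<le> s" "s \<le> t" "t \<le> 1" and "t \<le> a \<or> a + d \<le> s" for s t
  proof -
    have "P t - P s = 0"
      by (rule has_riemann_integral_eq_on[OF C1_primitiveD(4)[OF hP st] has_riemann_integral_zero])
        (use that h_supp in auto)
    then show ?thesis by simp
  qed
  define S where "S = {N (P t - P s) / (t - s) | s t. a \<le> s \<and> s < t \<and> t \<le> a + d}"
  define M where "M = Sup S"
  have S_bdd: "bdd_above S"
  proof (rule bdd_aboveI)
    fix r assume "r \<in> S"
    then obtain s t where "r = N (P t - P s) / (t - s)" "a \<le> s" "s < t" "t \<le> a + d" unfolding S_def by blast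
    then show "r \<le> \<kappa> * D" using P_Lip[of s t] ab d by (simp add: pos_divide_le_eq)
  qed
  have M_ge: "N (P t - P s) / (t - s) \<le> M" if "a \<le> s" "s < t" "t \<le> a + d" for s t
    unfolding M_def using that by (intro cSup_upper[OF _ S_bdd]) (auto simp: S_def)
  have "P 0 = P a" "P 1 = P (a + d)"
    using ab d P_const[of 0 a] P_const[of "a + d" 1] by auto
  moreover have "P 0 = 0" by (rule C1_primitiveD(1)[OF hP])
  moreover have "P 1 = (d / 6) *\<^sub>R y"
    unfolding P_def lz(4)[symmetric] scaleR_sum_right by (intro sum.cong) (auto simp: \<phi>_int)
  ultimately have "P (a + d) - P a = (d / 6) *\<^sub>R y" by simp
  then have "N y / 6 = N (P (a + d) - P a) / ((a + d) - a)"
    using d(1) by (simp add: N_scaleR)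
  also have "\<dots> \<le> M" by (rule M_ge) (use d(1) in auto)
  finally have "N y / 6 \<le> M" .
  moreover have "1 / e < N y / 6" using y(2) e(1) by (simp add: field_simps)
  ultimately have M: "1 / e \<le> M" by linarith
  have "1 \<le> 1 / e" using e by simp
  with M have M1: "1 \<le> M" by linarith
  have Me: "1 / M \<le> e" using M M1 e by (simp add: field_simps)
  have "N (P (a + d) - P a) / ((a + d) - a) \<in> S"
    unfolding S_def by (rule CollectI, rule exI[of _ a], rule exI[of _ "a + d"]) (use d(1) in simp)
  then have "S \<noteq> {}" by blast
  \<comment> \<open>The supremum need not be attained, so an average exceeding half of it is picked;
    normalisation turns this into the 1/2 of the conclusion.\<close>
  moreover have "M / 2 < Sup S" using M1 unfolding M_def by simp
  ultimately obtain r where "r \<in> S" "M / 2 < r" using less_cSup_iff[OF _ S_bdd] by blast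
  then obtain s0 t0 where st0: "a \<le> s0" "s0 < t0" "t0 \<le> a + d" "M / 2 < N (P t0 - P s0) / (t0 - s0)"
    unfolding S_def by blast
  have P_M: "N (P t - P s) \<le> M * \<bar>t - s\<bar>" if st: "s \<in> {0..1}" "t \<in> {0..1}" for s t
  proof -
    have le: "N (P t - P s) \<le> M * (t - s)" if st: "0 \<le> s" "s \<le> t" "t \<le> 1" for s t
    proof -
      \<comment> \<open>\<open>P\<close> is constant on either side of [a, a + d], so end points may
        be clamped to this interval, which does not increase distances.\<close>
      define cl where "cl v = max a (min (a + d) v)" for v
      have cl: "P (cl v) = P v" if "0 \<le> v" "v \<le> 1" for v
        using P_const[of a v] P_const[of v a] P_const[of "a + d" v] P_const[of v "a + d"] that ab d
        unfolding cl_def by (auto simp: max_def min_def)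
      have "N (P (cl t) - P (cl s)) \<le> M * (cl t - cl s)"
      proof (cases "cl s < cl t")
        case True
        then show ?thesis using M_ge[of "cl s" "cl t"] d(1)
          by (simp add: field_simps) (auto simp: cl_def)
      next
        case False
        then have "cl s = cl t" using st unfolding cl_def by (auto simp: max_def min_def split: if_splits)
        then show ?thesis by simp
      qed
      also have "\<dots> \<le> M * (t - s)"
        using M1 st unfolding cl_def by (intro mult_left_mono) (auto simp: max_def min_def)
      finally show ?thesis using st cl by simp
    qed
    show ?thesis
      using le[of s t] le[of t s] st by (cases "s \<le> t") (auto simp: N_minus_commute[of "P t"])
  qed
  define h' where "h' u = (1 / M) *\<^sub>R h u" for u
  define P' where "P' t = (1 / M) *\<^sub>R P t" for t
  have P'_diff: "N (P' t - P' s) = N (P t - P s) / M" for s t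
    using M1 by (simp add: P'_def N_scaleR flip: scaleR_diff_right)
  have h'_le: "N (h' u) \<le> e" for u
  proof -
    have "N (h' u) = N (h u) / M" using M1 by (simp add: h'_def N_scaleR)
    also have "\<dots> \<le> 1 / M" using h_le M1 by (intro divide_right_mono) auto
    finally show ?thesis using Me by linarith
  qed
  have e_le: "e \<le> \<epsilon>"
  proof -
    have "1 \<le> 3 * \<kappa>^2" using one_le_power[OF \<kappa>_ge_1, of 2] by linarith
    then have "1 * e \<le> 3 * \<kappa>^2 * e" using e(1) by (intro mult_right_mono) auto
    with e(3) show ?thesis by linarith
  qed
  have "C1_primitive h' P'"
  proof -
    \<comment> \<open>The factor 1 / M is absorbed into the vectors, so closure of
      \<open>C1_primitive\<close> under finite sums applies again.\<close>
    have "h' = (\<lambda>u. \<Sum>j<k. \<phi> j u *\<^sub>R ((1 / M) *\<^sub>R z j))"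
      "P' = (\<lambda>t. \<Sum>j<k. integral {0..t} (\<phi> j) *\<^sub>R ((1 / M) *\<^sub>R z j))"
      unfolding h'_def P'_def h_def P_def by (auto simp: fun_eq_iff scaleR_sum_right)
    then show ?thesis by (simp only:) (intro C1_primitive_sum C1_primitive_scaleR_const \<phi>_cont)
  qed
  moreover have "\<forall>u. u \<notin> {a<..<b} \<longrightarrow> h' u = 0"
    using h_supp d(2) by (auto simp: h'_def)
  moreover have "\<forall>u. N (h' u) \<le> \<epsilon>" using h'_le e_le order_trans by blast
  moreover have "N (riemann_sum h' p) \<le> \<epsilon>" if p: "p tagged_division_of {s..t}" "t - s \<le> 1" for p s t
  proof -
    have "N (riemann_sum h' p) \<le> \<kappa> * ((D / M) * (a + d - a) + \<kappa> * (e + e))"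
    proof (rule riemann_sum_localized[OF p])
      fix A :: "(real \<times> real set) set"
      have "h' = (\<lambda>u. (1 / M) *\<^sub>R h u)" by (simp add: fun_eq_iff h'_def)
      then have "riemann_sum h' A = (1 / M) *\<^sub>R riemann_sum h A" by (simp only: riemann_sum_scaleR)
      then have "N (riemann_sum h' A) = N (riemann_sum h A) / M" using M1 by (simp add: N_scaleR)
      also have "\<dots> \<le> D * (\<Sum>(x, K)\<in>A. measure lborel K) / M"
        using h_sum[of A] M1 by (intro divide_right_mono) auto
      finally show "N (riemann_sum h' A) \<le> (D / M) * (\<Sum>(x, K)\<in>A. measure lborel K)" by simp
    qed (use D d(1) M1 h_supp h'_le in \<open>auto simp: h'_def\<close>)
    also have "\<dots> \<le> \<kappa> * (\<kappa> * e + \<kappa> * (e + e))"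
    proof -
      have "D / M \<le> D / 1" using M1 D by (intro divide_left_mono) auto
      then have "(D / M) * d \<le> D * d" using d(1) by (intro mult_right_mono) auto
      also have "\<dots> \<le> e" by (rule d(3))
      also have "\<dots> \<le> \<kappa> * e" using \<kappa>_ge_1 e(1) by simp
      finally show ?thesis using \<kappa>_pos by (intro mult_left_mono) auto
    qed
    also have "\<dots> = 3 * \<kappa>^2 * e" by (simp add: power2_eq_square algebra_simps)
    also have "\<dots> \<le> \<epsilon>" by (rule e(3))
    finally show ?thesis .
  qed
  moreover have "\<forall>s\<in>{0..1}. \<forall>t\<in>{0..1}. N (P' t - P' s) \<le> \<bar>t - s\<bar>"
    using P_M M1 by (simp add: P'_diff field_simps)
  moreover have "a \<le> s0 \<and> s0 < t0 \<and> t0 \<le> b \<and> (t0 - s0) / 2 \<le> N (P' t0 - P' s0)"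
    using st0 d(2) M1 by (simp add: P'_diff field_simps)
  ultimately show ?thesis by blast
qed

section \<open>Averages in terms of the primitive\<close>

text \<open>Exchanging s and t changes the sign of numerator and denominator, so one quotient covers
  both off-diagonal cases.\<close>

lemma Ave_eq:
  assumes "C1_primitive f Q" "s \<in> {0..1}" "t \<in> {0..1}" "s \<noteq> t"
  shows "Ave N f (s, t) = (1 / (t - s)) *\<^sub>R (Q t - Q s)"
proof (cases "s < t")
  case True
  then have "riemann_integral N f s t = Q t - Q s"
    using assms by (intro riemann_integral_eq C1_primitiveD(4)) auto
  then show ?thesis using True by (simp add: Ave_def)
next
  case False
  with assms(4) have "t < s" by simp
  then have "riemann_integral N f t s = Q s - Q t"
    using assms by (intro riemann_integral_eq C1_primitiveD(4)) auto
  moreover have "(1 / (t - s)) *\<^sub>R (Q t - Q s) = (1 / (s - t)) *\<^sub>R (Q s - Q t)"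
    using scaleR_minus_left[of "1 / (s - t)" "Q t - Q s"] minus_divide_right[of 1 "s - t"]
    by (simp add: scaleR_diff_right)
  ultimately show ?thesis using \<open>t < s\<close> by (simp add: Ave_def)
qed

lemma Ave_diag: "Ave N f (c, c) = f c"
  by (simp add: Ave_def)

lemma Ave_commute: "Ave N f (s, t) = Ave N f (t, s)"
  by (auto simp: Ave_def)

lemma C1_primitive_continuous_map:
  assumes "C1_primitive f Q"
  shows "continuous_map (top_of_set {0..1}) (quasi_topology N) f"
  unfolding continuous_map_def
proof (intro conjI allI impI)
  fix U assume U: "openin (quasi_topology N) U"
  have "\<exists>\<delta>>0. \<forall>u\<in>{0..1}. dist u c < \<delta> \<longrightarrow> f u \<in> U" if c: "c \<in> {0..1}" "f c \<in> U" for c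
  proof -
    obtain \<epsilon> where \<epsilon>: "\<epsilon> > 0" "\<And>y. N (y - f c) < \<epsilon> \<Longrightarrow> y \<in> U"
      using U c(2) unfolding openin_quasi_topology by blast
    show ?thesis
      using C1_primitiveD(2)[OF assms c(1) \<epsilon>(1)] \<epsilon>(2) unfolding dist_real_def by blast
  qed
  then show "openin (top_of_set {0..1}) {x \<in> topspace (top_of_set {0..1}). f x \<in> U}"
    unfolding openin_euclidean_subtopology_iff by (auto; blast)
qed simp

lemma Ave_bounded:
  assumes "C1_primitive f Q"
    and "\<And>u. u \<in> {0..1} \<Longrightarrow> N (f u) \<le> B"
    and "\<And>s t. s \<in> {0..1} \<Longrightarrow> t \<in> {0..1} \<Longrightarrow> N (Q t - Q s) \<le> B * \<bar>t - s\<bar>"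
  shows "bounded_on_square N (Ave N f)"
  unfolding bounded_on_square_def
proof (rule bdd_aboveI2)
  fix z :: "real \<times> real" assume "z \<in> {0..1} \<times> {0..1}"
  then obtain s t where z: "z = (s, t)" and st: "s \<in> {0..1}" "t \<in> {0..1}" by blast
  show "N (Ave N f z) \<le> B"
  proof (cases "s = t")
    case True
    then show ?thesis using assms(2) st z by (simp add: Ave_diag)
  next
    case False
    then show ?thesis
      using assms(3)[OF st] st z
      by (simp add: Ave_eq[OF assms(1)] N_scaleR pos_divide_le_eq)
  qed
qed

text \<open>On the diagonal the average is a difference quotient of \<open>Q\<close>, and
  differentiability gives the limit. Off the diagonal the Lipschitz bound suffices, because the
  denominator stays away from 0.\<close>

lemma Ave_limitin:
  assumes prim: "C1_primitive f Q"
    and Lip: "\<And>s t. s \<in> {0..1} \<Longrightarrow> t \<in> {0..1} \<Longrightarrow> N (Q t - Q s) \<le> B * \<bar>t - s\<bar>"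
    and st: "s \<in> {0..1}" "t \<in> {0..1}"
  shows "limitin (quasi_topology N) (\<lambda>v. Ave N f (s, v)) (Ave N f (s, t)) (at t within {0..1})"
proof (rule limitin_quasi_topologyI)
  fix \<epsilon> :: real assume \<epsilon>: "\<epsilon> > 0"
  show "eventually (\<lambda>v. N (Ave N f (s, v) - Ave N f (s, t)) < \<epsilon>) (at t within {0..1})"
  proof (cases "s = t")
    case True
    obtain \<delta> where \<delta>: "\<delta> > 0" "\<And>v. v \<in> {0..1} \<Longrightarrow> \<bar>v - t\<bar> < \<delta> \<Longrightarrow>
        N (Q v - Q t - (v - t) *\<^sub>R f t) \<le> \<epsilon> / 2 * \<bar>v - t\<bar>"
      using C1_primitiveD(3)[OF prim st(2), of "\<epsilon> / 2"] \<epsilon> by auto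
    have "N (Ave N f (s, v) - Ave N f (s, t)) < \<epsilon>"
      if v: "v \<in> {0..1}" "v \<noteq> t" "dist v t < \<delta>" for v
    proof -
      have "Ave N f (s, v) - Ave N f (s, t) = (1 / (v - t)) *\<^sub>R (Q v - Q t) - f t"
        using v st True by (simp add: Ave_eq[OF prim] Ave_diag)
      also have "\<dots> = (1 / (v - t)) *\<^sub>R (Q v - Q t - (v - t) *\<^sub>R f t)"
        using v(2) by (simp add: scaleR_diff_right)
      finally have "N (Ave N f (s, v) - Ave N f (s, t)) = N (Q v - Q t - (v - t) *\<^sub>R f t) / \<bar>v - t\<bar>"
        by (simp add: N_scaleR)
      also have "\<dots> \<le> \<epsilon> / 2"
        using \<delta>(2)[of v] v by (simp add: pos_divide_le_eq dist_real_def)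
      finally show ?thesis using \<epsilon> by simp
    qed
    then show ?thesis using \<delta>(1) unfolding eventually_at by blast
  next
    case False
    \<comment> \<open>The difference of two quotients is split into a change of the numerator and a
      change of the denominator. As \<open>N\<close> may be discontinuous, the limit is taken of
      this real bound.\<close>
    define g where "g v = \<kappa> * (\<bar>1 / (v - s)\<bar> * (B * \<bar>v - t\<bar>) +
      \<bar>1 / (v - s) - 1 / (t - s)\<bar> * N (Q t - Q s))" for v
    have "(g \<longlongrightarrow> g t) (at t within {0..1})"
      unfolding g_def using False by (intro tendsto_intros) auto
    moreover have "g t = 0" by (simp add: g_def)
    ultimately have "eventually (\<lambda>v. g v < \<epsilon>) (at t within {0..1})"
      using order_tendstoD(2) \<epsilon> by metis
    moreover have "eventually (\<lambda>v. v \<noteq> s) (at t within {0..1})"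
      using False by (intro tendsto_imp_eventually_ne[OF tendsto_ident_at]) auto
    moreover have "eventually (\<lambda>v. v \<in> {0..1}) (at t within {0..1})"
      by (simp add: eventually_at_filter)
    ultimately show ?thesis
    proof eventually_elim
      case (elim v)
      have "Ave N f (s, v) - Ave N f (s, t) =
          (1 / (v - s)) *\<^sub>R (Q v - Q s) - (1 / (t - s)) *\<^sub>R (Q t - Q s)"
        using elim st False by (simp add: Ave_eq[OF prim])
      also have "\<dots> = (1 / (v - s)) *\<^sub>R (Q v - Q t) + (1 / (v - s) - 1 / (t - s)) *\<^sub>R (Q t - Q s)"
        by (simp add: algebra_simps)
      also have "N \<dots> \<le> g v"
        unfolding g_def using Lip[OF st(2) elim(3)]
        by (intro N_triangle_mono) (simp_all only: N_scaleR, intro mult_left_mono, auto)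
      finally show ?case using elim(1) by linarith
    qed
  qed
qed

lemma Ave_separately_continuous:
  assumes "C1_primitive f Q"
    and "\<And>s t. s \<in> {0..1} \<Longrightarrow> t \<in> {0..1} \<Longrightarrow> N (Q t - Q s) \<le> B * \<bar>t - s\<bar>"
  shows "separately_continuous N (Ave N f)"
  unfolding separately_continuous_def
proof (intro ballI conjI)
  fix s t :: real assume st: "s \<in> {0..1}" "t \<in> {0..1}"
  show "limitin (quasi_topology N) (\<lambda>v. Ave N f (s, v)) (Ave N f (s, t)) (at t within {0..1})"
    using assms st by (rule Ave_limitin)
  have "limitin (quasi_topology N) (\<lambda>v. Ave N f (t, v)) (Ave N f (t, s)) (at s within {0..1})"
    using assms st(2,1) by (rule Ave_limitin)
  then show "limitin (quasi_topology N) (\<lambda>v. Ave N f (v, t)) (Ave N f (s, t)) (at s within {0..1})"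
    by (simp only: Ave_commute[of f t])
qed

section \<open>Geometrically decaying series\<close>

text \<open>The subtracted term lets the induction close; 2 is a convenient constant above the exact
  8/7.\<close>

lemma sum_eighth_powers_le:
  "n \<le> m \<Longrightarrow> (\<Sum>k=n..<m. (1/8)^k) \<le> 2 * (1/8)^n - 2 * (1/8::real)^m"
proof (induction rule: dec_induct)
  case (step j)
  have "(0::real) \<le> (1/8)^j" by simp
  moreover have "(\<Sum>k=n..<Suc j. (1/8::real)^k) = (\<Sum>k=n..<j. (1/8)^k) + (1/8)^j"
    using step(1) by simp
  moreover have "(1/8::real)^Suc j = (1/8)^j / 8" by simp
  ultimately show ?case using step(3) by linarith
qed simp

text \<open>Of the exponent k + 2, the part k + 1 cancels the weights of
  \<open>N_sum_atLeastLessThan_le\<close>; the remaining 1 / \<kappa> pays for a passage to the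
  limit.\<close>

lemma N_sum_geometric_le:
  assumes "\<And>k. N (y k) \<le> (1/8)^k / \<kappa> ^ (k + 2)"
  shows "N (\<Sum>k=n..<m. y k) \<le> 2 * (1/8)^n / \<kappa>"
proof (cases "n \<le> m")
  case True
  have "N (\<Sum>k=n..<m. y k) \<le> (\<Sum>k=n..<m. \<kappa> ^ Suc k * N (y k))" by (rule N_sum_atLeastLessThan_le)
  also have "\<dots> \<le> (\<Sum>k=n..<m. (1/8)^k / \<kappa>)"
  proof (rule sum_mono)
    fix k
    have "\<kappa> ^ Suc k * N (y k) \<le> \<kappa> ^ Suc k * ((1/8)^k / \<kappa> ^ (k + 2))"
      using \<kappa>_pos assms by (intro mult_left_mono) auto
    also have "\<dots> = (1/8)^k / \<kappa>" using \<kappa>_pos by simp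
    finally show "\<kappa> ^ Suc k * N (y k) \<le> (1/8)^k / \<kappa>" .
  qed
  also have "\<dots> = (\<Sum>k=n..<m. (1/8)^k) / \<kappa>" by (rule sum_divide_distrib[symmetric])
  also have "\<dots> \<le> (2 * (1/8)^n) / \<kappa>"
  proof (rule divide_right_mono)
    have "(0::real) \<le> 2 * (1/8)^m" by simp
    with sum_eighth_powers_le[OF True] show "(\<Sum>k=n..<m. (1/8)^k) \<le> 2 * (1/8::real)^n" by linarith
  qed (use \<kappa>_pos in simp)
  finally show ?thesis .
qed (use \<kappa>_pos in simp)

text \<open>The limit loses a factor \<kappa> in \<open>N_le_of_approx\<close>, which the 1 /
  \<kappa> of the tail estimate cancels.\<close>

lemma series_converges:
  assumes "quasi_complete N" and y: "\<And>k. N (y k) \<le> (1/8)^k / \<kappa> ^ (k + 2)"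
  shows "\<exists>L. \<forall>n. N (L - (\<Sum>k<n. y k)) \<le> 2 * (1/8)^n"
proof -
  define S where "S n = (\<Sum>k<n. y k)" for n
  have diff: "N (S m - S n) \<le> 2 * (1/8)^n / \<kappa>" if "n \<le> m" for m n
  proof -
    have "S m - S n = (\<Sum>k=n..<m. y k)"
      unfolding S_def using sum_diff_nat_ivl[of 0 n m y] that by (simp add: lessThan_atLeast0)
    then show ?thesis using N_sum_geometric_le[OF y] by simp
  qed
  have "\<exists>M. \<forall>m\<ge>M. \<forall>n\<ge>M. N (S m - S n) < \<epsilon>" if "\<epsilon> > 0" for \<epsilon>
  proof -
    have "0 < \<epsilon> * \<kappa> / 2" using that \<kappa>_pos by simp
    from real_arch_pow_inv[OF this, of "1/8"]
    obtain M where "(1/8::real)^M < \<epsilon> * \<kappa> / 2" by auto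
    then have M: "2 * (1/8)^M / \<kappa> < \<epsilon>" using \<kappa>_pos by (simp add: field_simps)
    have "N (S m - S n) < \<epsilon>" if "M \<le> n" "n \<le> m" for m n
    proof -
      have "(1/8::real)^n \<le> (1/8)^M" using that by (intro power_decreasing) auto
      then have "2 * (1/8)^n / \<kappa> \<le> 2 * (1/8)^M / \<kappa>" using \<kappa>_pos by (intro divide_right_mono) auto
      with diff[OF that(2)] M show ?thesis by linarith
    qed
    then show ?thesis by (metis N_minus_commute nle_le)
  qed
  with assms(1) obtain L where L: "(\<lambda>n. N (S n - L)) \<longlonglongrightarrow> 0"
    unfolding quasi_complete_def by blast
  have "N (L - S n) \<le> \<kappa> * (2 * (1/8)^n / \<kappa>)" for n
  proof (rule N_le_of_approx)
    fix \<epsilon> :: real assume "\<epsilon> > 0"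
    then have "eventually (\<lambda>m. N (S m - L) < \<epsilon>) sequentially" using L by (auto dest: order_tendstoD)
    then obtain m where "m \<ge> n" "N (S m - L) < \<epsilon>"
      unfolding eventually_sequentially by (meson nle_le)
    then show "\<exists>y. N (y - (L - S n)) < \<epsilon> \<and> N y \<le> 2 * (1/8)^n / \<kappa>"
      using diff by (intro exI[of _ "S m - S n"]) simp
  qed
  then show ?thesis using \<kappa>_pos unfolding S_def by auto
qed

end

lemma dyadic_interval_exists:
  fixes u :: real
  assumes "0 < u" "u \<le> 1"
  obtains n where "(1/2)^Suc n < u" "u \<le> (1/2)^n"
proof -
  obtain m where m: "(1/2)^m < u" using real_arch_pow_inv[OF assms(1), of "1/2"] by auto
  have "\<exists>n. (1/2)^Suc n < u \<and> u \<le> (1/2)^n"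
    using m
  proof (induction m)
    case 0
    then show ?case using assms by simp
  next
    case (Suc m)
    then show ?case by (cases "(1/2)^m < u") (auto simp: not_less)
  qed
  then show ?thesis using that by blast
qed

section \<open>The series of all blocks\<close>

text \<open>Block k lives in the left half of the dyadic interval from (1/2)^(k + 1) to (1/2)^k; the
  right half is the gap below block k - 1. In the exponent k + 3 one factor \<kappa> is reserved for
  passing from Riemann sums to \<open>P k\<close>, which leaves the k + 2 of
  \<open>series_converges\<close>.\<close>

locale block_sequence = quasi_normed +
  fixes h P :: "nat \<Rightarrow> real \<Rightarrow> 'a"
  assumes complete: "quasi_complete N"
    and prim: "C1_primitive (h k) (P k)"
    and supp: "u \<notin> {(1/2)^Suc k<..<3/4 * (1/2)^k} \<Longrightarrow> h k u = 0"
    and small: "N (h k u) \<le> (1/8)^k / \<kappa> ^ (k + 3)"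
    and rsum: "p tagged_division_of {s..t} \<Longrightarrow> t - s \<le> 1 \<Longrightarrow>
      N (riemann_sum (h k) p) \<le> (1/8)^k / \<kappa> ^ (k + 3)"
    and Lip: "s \<in> {0..1} \<Longrightarrow> t \<in> {0..1} \<Longrightarrow> N (P k t - P k s) \<le> \<bar>t - s\<bar>"
    and large: "\<exists>s t. (1/2)^Suc k \<le> s \<and> s < t \<and> t \<le> 3/4 * (1/2)^k \<and> (t - s) / 2 \<le> N (P k t - P k s)"
begin

text \<open>The supports of the blocks are disjoint, so at most one term of the sum is nonzero.\<close>

definition f :: "real \<Rightarrow> 'a" where "f u = (\<Sum>k | h k u \<noteq> 0. h k u)"

definition F :: "nat \<Rightarrow> real \<Rightarrow> 'a" where "F n u = (\<Sum>k<n. h k u)"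

definition G :: "nat \<Rightarrow> real \<Rightarrow> 'a" where "G n t = (\<Sum>k<n. P k t)"

lemma half_power_mono: "j \<le> k \<Longrightarrow> (1/2::real)^k \<le> (1/2)^j"
  by (intro power_decreasing) auto

lemma h_eq_0_left: "j < k \<Longrightarrow> u \<le> (1/2)^k \<Longrightarrow> h j u = 0"
  using half_power_mono[of "Suc j" k] by (intro supp) auto

lemma h_eq_0_right:
  assumes "k \<le> j" "3/4 * (1/2)^k \<le> u"
  shows "h j u = 0"
proof -
  have "3/4 * (1/2)^j \<le> u" using half_power_mono[OF assms(1)] assms(2) by linarith
  then show ?thesis by (intro supp) auto
qed

text \<open>The range starts at the right end of block k + 1, includes the gap above it, and stops
  at the left end of block k - 1, so it meets the support of block k alone.\<close>

lemma f_eq_h: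
  assumes "3/4 * (1/2)^Suc k \<le> u" "u \<le> (1/2)^k"
  shows "f u = h k u"
proof -
  have "h j u = 0" if "j \<noteq> k" for j
    using h_eq_0_left[of j k u] h_eq_0_right[of "Suc k" j u] assms that
    by (cases j k rule: linorder_cases) auto
  then have "{j. h j u \<noteq> 0} \<subseteq> {k}" by auto
  then have "f u = (\<Sum>j\<in>{k}. h j u)"
    unfolding f_def by (intro sum.mono_neutral_left) auto
  then show ?thesis by simp
qed

lemma f_eq_F:
  assumes "3/4 * (1/2)^n \<le> u"
  shows "f u = F n u"
proof -
  have "h j u = 0" if "n \<le> j" for j using that assms by (rule h_eq_0_right)
  then have "{j. h j u \<noteq> 0} \<subseteq> {..<n}" by (auto simp: not_le[symmetric])
  then show ?thesis unfolding f_def F_def by (intro sum.mono_neutral_left) auto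
qed

lemma h_0 [simp]: "h k 0 = 0" by (rule supp) simp

lemma f_0 [simp]: "f 0 = 0" by (simp add: f_def)

lemma small_half_power:
  assumes "u > (0::real)"
  obtains n where "3/4 * (1/2)^n < u"
proof -
  obtain n where n: "(1/2)^n < u" using real_arch_pow_inv[OF assms, of "1/2"] by auto
  moreover have "3/4 * (1/2)^n \<le> (1/2::real)^n" by simp
  ultimately have "3/4 * (1/2)^n < u" by linarith
  then show ?thesis by (rule that)
qed

lemma eventually_f_eq_F:
  assumes "u \<ge> 0"
  shows "eventually (\<lambda>n. f u = F n u) sequentially"
proof (cases "u = 0")
  case True
  then show ?thesis by (simp add: F_def)
next
  case False
  with assms obtain n where n: "3/4 * (1/2)^n < u" using small_half_power[of u] by auto
  have "f u = F m u" if "n \<le> m" for m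
    using half_power_mono[OF that] n by (intro f_eq_F) linarith
  then show ?thesis unfolding eventually_sequentially by blast
qed

lemma small_le: "(1/8)^k / \<kappa> ^ j \<le> (1/8)^k"
  using one_le_power[OF \<kappa>_ge_1, of j] by (simp add: divide_le_eq mult_le_cancel_left1)

text \<open>Gives continuity at 0 and boundedness of \<open>f\<close> at once.\<close>

lemma N_f_le:
  assumes "u \<in> {0..1}"
  shows "N (f u) \<le> 2 * u"
proof (cases "u = 0")
  case False
  with assms obtain n where n: "(1/2)^Suc n < u" "u \<le> (1/2)^n"
    using dyadic_interval_exists[of u] by auto
  then have "f u = h n u" by (intro f_eq_h) auto
  also have "N \<dots> \<le> (1/8)^n" using small[of n u] small_le[of n "n + 3"] by linarith
  also have "\<dots> \<le> (1/2)^n" by (intro power_mono) auto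
  finally show ?thesis using n by simp
qed simp

lemma F_G: "C1_primitive (F n) (G n)"
  unfolding F_def G_def by (intro C1_primitive_sum prim)

lemma N_P_le:
  assumes "t \<in> {0..1}"
  shows "N (P k t) \<le> (1/8)^k / \<kappa> ^ (k + 2)"
proof -
  have "N (P k t - P k 0) \<le> \<kappa> * ((1/8)^k / \<kappa> ^ (k + 3))"
    using assms by (intro has_riemann_integral_bound[OF C1_primitiveD(4)[OF prim]] rsum) auto
  also have "\<dots> = (1/8)^k / \<kappa> ^ (k + 2)" using \<kappa>_pos by (simp add: numeral_eq_Suc)
  finally show ?thesis by (simp add: C1_primitiveD(1)[OF prim])
qed

text \<open>The sum of the series of the \<open>P k t\<close>. For t in [0, 1] such an
  \<open>L\<close> exists, and the error bounds force it to be the limit of the partial sums, hence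
  unique.\<close>

definition Q :: "real \<Rightarrow> 'a" where "Q t = (SOME L. \<forall>n. N (L - G n t) \<le> 2 * (1/8)^n)"

lemma Q_approx:
  assumes "t \<in> {0..1}"
  shows "N (Q t - G n t) \<le> 2 * (1/8)^n"
proof -
  have "\<exists>L. \<forall>n. N (L - G n t) \<le> 2 * (1/8)^n"
    unfolding G_def using assms by (intro series_converges complete N_P_le)
  from someI_ex[OF this] show ?thesis unfolding Q_def by blast
qed

lemma Q_diff_approx:
  assumes "s \<in> {0..1}" "t \<in> {0..1}"
  shows "N ((Q t - Q s) - (G n t - G n s)) \<le> \<kappa> * (4 * (1/8)^n)"
proof -
  have "N ((Q t - G n t) + (G n s - Q s)) \<le> \<kappa> * (2 * (1/8)^n + 2 * (1/8)^n)"
    using assms Q_approx N_minus_commute[of "G n s"] by (intro N_triangle_mono) auto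
  then show ?thesis by (simp add: algebra_simps)
qed

text \<open>A division has finitely many tags, so its Riemann sum for \<open>f\<close> equals that
  for some \<open>F m\<close>, with m depending on the division. The blocks from n to m are bounded
  by \<open>rsum\<close> for every division, so the error is free of m.\<close>

lemma riemann_sum_f_approx:
  assumes p: "p tagged_division_of {s..t}" and "0 \<le> s" "t \<le> 1"
  shows "N (riemann_sum f p - riemann_sum (F n) p) \<le> 2 * (1/8)^n"
proof -
  have "eventually (\<lambda>m. f (fst z) = F m (fst z)) sequentially" if "z \<in> p" for z
    using tagged_division_ofD(2,3)[OF p, of "fst z" "snd z"] that assms
    by (intro eventually_f_eq_F) force
  then have "eventually (\<lambda>m. \<forall>z\<in>p. f (fst z) = F m (fst z)) sequentially"
    using tagged_division_ofD(1)[OF p] by (simp add: eventually_ball_finite)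
  then obtain m where m: "n \<le> m" "\<And>z. z \<in> p \<Longrightarrow> f (fst z) = F m (fst z)"
    unfolding eventually_sequentially by (meson nle_le)
  have "riemann_sum f p = riemann_sum (F m) p"
    unfolding riemann_sum_def using m(2) by (intro sum.cong) (auto simp: case_prod_unfold)
  moreover have "riemann_sum (F m) p - riemann_sum (F n) p = (\<Sum>k=n..<m. riemann_sum (h k) p)"
    unfolding F_def riemann_sum_sum lessThan_atLeast0 using m(1) by (simp add: sum_diff_nat_ivl)
  moreover have "N (riemann_sum (h k) p) \<le> (1/8)^k / \<kappa> ^ (k + 2)" for k
  proof -
    have "N (riemann_sum (h k) p) \<le> (1/8)^k / \<kappa> ^ (k + 3)" using assms by (intro rsum) auto
    also have "\<dots> \<le> (1/8)^k / \<kappa> ^ (k + 2)"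
      using \<kappa>_ge_1 \<kappa>_pos by (intro divide_left_mono power_increasing) auto
    finally show ?thesis .
  qed
  then have "N (\<Sum>k=n..<m. riemann_sum (h k) p) \<le> 2 * (1/8)^n / \<kappa>" by (rule N_sum_geometric_le)
  moreover have "2 * (1/8)^n / \<kappa> \<le> 2 * (1/8::real)^n"
    using \<kappa>_ge_1 by (simp add: divide_le_eq mult_le_cancel_left1)
  ultimately show ?thesis by simp
qed

text \<open>Interchange of series and integral: n is fixed first by tail estimates that are uniform
  in the division, and the mesh is then chosen for \<open>F n\<close> alone.\<close>

lemma f_has_riemann_integral:
  assumes st: "0 \<le> s" "s \<le> t" "t \<le> 1"
  shows "has_riemann_integral N f (Q t - Q s) s t"
proof (rule has_riemann_integralI)
  fix \<epsilon> :: real assume "\<epsilon> > 0"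
  then have e: "\<epsilon> / (2 * \<kappa>) > 0" using \<kappa>_pos by simp
  \<comment> \<open>The two tail errors combine to \<kappa> (2 + 4 \<kappa>) (1/8)^n, at most 6
    \<kappa>^2 (1/8)^n.\<close>
  have "0 < 6 * \<kappa>^2" using \<kappa>_pos by simp
  with e have "0 < \<epsilon> / (2 * \<kappa>) / (6 * \<kappa>^2)" by (rule divide_pos_pos)
  from real_arch_pow_inv[OF this, of "1/8"]
  obtain n where "(1/8)^n < \<epsilon> / (2 * \<kappa>) / (6 * \<kappa>^2)" by auto
  then have n: "6 * \<kappa>^2 * (1/8)^n < \<epsilon> / (2 * \<kappa>)"
    using \<kappa>_pos by (simp add: pos_less_divide_eq mult_ac)
  obtain \<delta> where \<delta>: "\<delta> > 0" "\<And>p. p tagged_division_of {s..t} \<Longrightarrow>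
      (\<And>x K. (x, K)\<in>p \<Longrightarrow> measure lborel K < \<delta>) \<Longrightarrow>
      N (riemann_sum (F n) p - (G n t - G n s)) < \<epsilon> / (2 * \<kappa>)"
    using has_riemann_integralE[OF C1_primitiveD(4)[OF F_G st] e] by blast
  have "N (riemann_sum f p - (Q t - Q s)) < \<epsilon>"
    if p: "p tagged_division_of {s..t}" and fine: "\<forall>(x, K)\<in>p. measure lborel K < \<delta>" for p
  proof -
    have "N ((riemann_sum f p - riemann_sum (F n) p) + ((G n t - G n s) - (Q t - Q s)))
        \<le> \<kappa> * (2 * (1/8)^n + \<kappa> * (4 * (1/8)^n))"
      using riemann_sum_f_approx[OF p] Q_diff_approx[of s t n] st
      by (intro N_triangle_mono) (auto simp: N_minus_commute[of "G n t - G n s"])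
    also have "\<dots> \<le> \<kappa> * (\<kappa> * (2 * (1/8)^n) + \<kappa> * (4 * (1/8)^n))"
      using \<kappa>_ge_1 by (intro mult_left_mono add_right_mono) (auto simp: mult_le_cancel_right1)
    also have "\<dots> = 6 * \<kappa>^2 * (1/8)^n" by (simp add: power2_eq_square algebra_simps)
    finally have "N ((riemann_sum f p - riemann_sum (F n) p) + ((G n t - G n s) - (Q t - Q s)))
      < \<epsilon> / (2 * \<kappa>)" using n by linarith
    moreover have "N (riemann_sum (F n) p - (G n t - G n s)) < \<epsilon> / (2 * \<kappa>)"
      using p fine by (intro \<delta>(2)) auto
    ultimately have "N (((riemann_sum f p - riemann_sum (F n) p) + ((G n t - G n s) - (Q t - Q s)))
        + (riemann_sum (F n) p - (G n t - G n s))) < \<epsilon>" by (rule N_triangle_less)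
    then show ?thesis by (simp add: algebra_simps)
  qed
  with \<delta>(1) show "\<exists>\<delta>>0. \<forall>p. p tagged_division_of {s..t} \<longrightarrow>
      (\<forall>(x, K)\<in>p. measure lborel K < \<delta>) \<longrightarrow> N (riemann_sum f p - (Q t - Q s)) < \<epsilon>" by blast
qed

lemma Q_diff_eq_P:
  assumes "3/4 * (1/2)^Suc n \<le> s" "s \<le> t" "t \<le> (1/2)^n"
  shows "Q t - Q s = P n t - P n s"
proof -
  have "(0::real) \<le> 3/4 * (1/2)^Suc n" "(1/2::real)^n \<le> 1" by (auto simp: power_le_one)
  then have st: "0 \<le> s" "s \<le> t" "t \<le> 1" using assms by linarith+
  show ?thesis
    by (rule has_riemann_integral_eq_on[OF f_has_riemann_integral[OF st] C1_primitiveD(4)[OF prim st]])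
      (use assms f_eq_h in auto)
qed

lemma Q_diff_eq_G:
  assumes "3/4 * (1/2)^n \<le> s" "3/4 * (1/2)^n \<le> t" "s \<le> 1" "t \<le> 1"
  shows "Q t - Q s = G n t - G n s"
proof -
  have le: "Q t - Q s = G n t - G n s" if "3/4 * (1/2)^n \<le> s" "s \<le> t" "t \<le> 1" for s t
  proof -
    have "(0::real) \<le> 3/4 * (1/2)^n" by simp
    with that(1) have "0 \<le> s" by (rule order_trans[rotated])
    with that have st: "0 \<le> s" "s \<le> t" "t \<le> 1" by auto
    show ?thesis
      by (rule has_riemann_integral_eq_on[OF f_has_riemann_integral[OF st] C1_primitiveD(4)[OF F_G st]])
        (use that f_eq_F in auto)
  qed
  show ?thesis
  proof (cases "s \<le> t")
    case False
    then have "Q s - Q t = G n s - G n t" using assms by (intro le) auto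
    then show ?thesis by (metis minus_diff_eq)
  qed (use assms le in auto)
qed

lemma G_Suc_diff:
  assumes "0 \<le> s" "s \<le> t" "t \<le> (1/2)^n"
  shows "G (Suc n) t - G (Suc n) s = P n t - P n s" "G n t = G n s"
proof -
  have "(1/2::real)^n \<le> 1" by (auto simp: power_le_one)
  with assms have st: "0 \<le> s" "s \<le> t" "t \<le> 1" by auto
  have "P k t - P k s = 0" if "k < n" for k
    by (rule has_riemann_integral_eq_on[OF C1_primitiveD(4)[OF prim st] has_riemann_integral_zero])
      (use that assms h_eq_0_left in auto)
  then have "P k t = P k s" if "k < n" for k using that by simp
  then show "G n t = G n s" unfolding G_def by (intro sum.cong) auto
  then show "G (Suc n) t - G (Suc n) s = P n t - P n s" by (simp add: G_def)
qed

lemma G_0: "G n 0 = 0"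
  by (rule C1_primitiveD(1)[OF F_G])

lemma Q_0: "Q 0 = 0"
proof (rule N_eq_zero_of_approx)
  fix \<epsilon> :: real assume "\<epsilon> > 0"
  then obtain n where "(1/8)^n < \<epsilon> / 2" using real_arch_pow_inv[of "\<epsilon> / 2" "1/8"] by auto
  then show "N (Q 0) < \<epsilon>" using Q_approx[of 0 n] by (simp add: G_0)
qed

text \<open>For t at scale (1/2)^n the blocks before n lie to the right of t, so \<open>Q t\<close>
  is a tail of size (1/8)^n, the cube of the scale. A cubic bound makes the derivative of
  \<open>Q\<close> at 0 vanish.\<close>

lemma N_Q_le:
  assumes "t \<in> {0..1}"
  shows "N (Q t) \<le> 16 * t^3"
proof (cases "t = 0")
  case False
  with assms obtain n where n: "(1/2)^Suc n < t" "t \<le> (1/2)^n"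
    using dyadic_interval_exists[of t] by auto
  have "G n t = 0" using G_Suc_diff(2)[of 0 t n] assms n G_0 by simp
  then have "N (Q t) \<le> 2 * (1/8)^n" using Q_approx[OF assms, of n] by simp
  also have "\<dots> = 16 * ((1/2)^3)^Suc n" by (simp add: power3_eq_cube)
  also have "\<dots> = 16 * ((1/2)^Suc n)^3" by (simp only: power_mult[symmetric] mult.commute)
  also have "\<dots> \<le> 16 * t^3" using n by (intro mult_left_mono power_mono) auto
  finally show ?thesis .
qed (simp add: Q_0)

text \<open>Adding the bounds of all blocks met by an interval would accumulate powers of \<kappa>.
  Instead, either the interval meets block n alone, or it crosses the whole gap above block n + 1
  and is so long that its length dominates the integrals of all later blocks.\<close>

lemma Q_Lip:
  assumes "s \<in> {0..1}" "t \<in> {0..1}"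
  shows "N (Q t - Q s) \<le> \<kappa> * (1 + 4 * \<kappa>) * \<bar>t - s\<bar>"
proof -
  have le: "N (Q t - Q s) \<le> \<kappa> * (1 + 4 * \<kappa>) * (t - s)" if st: "0 \<le> s" "s < t" "t \<le> 1" for s t
  proof -
    have \<kappa>1: "1 \<le> \<kappa> * (1 + 4 * \<kappa>)"
      using mult_mono[of 1 \<kappa> 1 "1 + 4 * \<kappa>"] \<kappa>_ge_1 by simp
    obtain n where n: "(1/2)^Suc n < t" "t \<le> (1/2)^n"
      using dyadic_interval_exists[of t] st by auto
    have Lip': "N (P n t - P n s) \<le> t - s" using Lip[of s t n] st by simp
    show ?thesis
    proof (cases "3/4 * (1/2)^Suc n \<le> s")
      case True
      then have "N (Q t - Q s) \<le> 1 * (t - s)" using Lip' Q_diff_eq_P[of n s t] st n by simp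
      also have "\<dots> \<le> \<kappa> * (1 + 4 * \<kappa>) * (t - s)" using \<kappa>1 st by (intro mult_right_mono) auto
      finally show ?thesis .
    next
      case False
      \<comment> \<open>The gap between 3/4 (1/2)^(n + 1) and (1/2)^(n + 1) has length (1/2)^n /
        8.\<close>
      then have gap: "(1/2)^n \<le> 8 * (t - s)" using n(1) by simp
      have G: "G (Suc n) t - G (Suc n) s = P n t - P n s" using st n by (intro G_Suc_diff) auto
      have "(1/8::real)^n \<le> (1/2)^n" by (intro power_mono) auto
      then have "4 * (1/8)^Suc n \<le> 4 * (t - s)" using gap by simp
      then have tail: "\<kappa> * (4 * (1/8)^Suc n) \<le> \<kappa> * (4 * (t - s))"
        using \<kappa>_pos by (intro mult_left_mono) auto
      have "N ((P n t - P n s) + ((Q t - Q s) - (G (Suc n) t - G (Suc n) s)))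
          \<le> \<kappa> * ((t - s) + \<kappa> * (4 * (t - s)))"
        using Lip' Q_diff_approx[of s t "Suc n"] tail st by (intro N_triangle_mono) auto
      then show ?thesis by (simp add: G algebra_simps)
    qed
  qed
  consider "s = t" | "s < t" | "t < s" by linarith
  then show ?thesis
    using le[of s t] le[of t s] assms by cases (auto simp: N_minus_commute[of "Q t"])
qed

text \<open>At 0 the bounds \<open>N_f_le\<close> and \<open>N_Q_le\<close> give continuity and
  derivative 0; near any other point \<open>f\<close> and the increments of \<open>Q\<close>
  coincide with those of a finite partial sum.\<close>

lemma f_Q: "C1_primitive f Q"
  unfolding C1_primitive_def
proof (intro conjI ballI allI impI)
  show "Q 0 = 0" by (rule Q_0)
next
  fix c \<epsilon> :: real assume c: "c \<in> {0..1}" and \<epsilon>: "\<epsilon> > 0"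
  show "\<exists>\<delta>>0. \<forall>u\<in>{0..1}. \<bar>u - c\<bar> < \<delta> \<longrightarrow> N (f u - f c) < \<epsilon>"
  proof (cases "c = 0")
    case True
    then show ?thesis
      using N_f_le \<epsilon> by (intro exI[of _ "\<epsilon> / 2"]) fastforce
  next
    case False
    with c obtain n where n: "3/4 * (1/2)^n < c" using small_half_power[of c] by auto
    obtain \<delta> where \<delta>: "\<delta> > 0" "\<And>u. u \<in> {0..1} \<Longrightarrow> \<bar>u - c\<bar> < \<delta> \<Longrightarrow> N (F n u - F n c) < \<epsilon>"
      using C1_primitiveD(2)[OF F_G c \<epsilon>] by blast
    have "N (f u - f c) < \<epsilon>" if u: "u \<in> {0..1}" "\<bar>u - c\<bar> < min \<delta> (c - 3/4 * (1/2)^n)" for u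
    proof -
      have "3/4 * (1/2)^n \<le> u" "3/4 * (1/2)^n \<le> c" using u(2) n by linarith+
      then have "f u = F n u" "f c = F n c" by (simp_all only: f_eq_F)
      then show ?thesis using u \<delta>(2)[of u] by simp
    qed
    then show ?thesis using \<delta>(1) n by (intro exI[of _ "min \<delta> (c - 3/4 * (1/2)^n)"]) auto
  qed
next
  fix c \<epsilon> :: real assume c: "c \<in> {0..1}" and \<epsilon>: "\<epsilon> > 0"
  show "\<exists>\<delta>>0. \<forall>t\<in>{0..1}. \<bar>t - c\<bar> < \<delta> \<longrightarrow> N (Q t - Q c - (t - c) *\<^sub>R f c) \<le> \<epsilon> * \<bar>t - c\<bar>"
  proof (cases "c = 0")
    case True
    have "N (Q t - Q c - (t - c) *\<^sub>R f c) \<le> \<epsilon> * \<bar>t - c\<bar>" if t: "t \<in> {0..1}" "\<bar>t - c\<bar> < \<epsilon> / 16" for t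
    proof -
      have "N (Q t - Q c - (t - c) *\<^sub>R f c) \<le> 16 * t^3"
        using N_Q_le[OF t(1)] True by (simp add: Q_0)
      also have "\<dots> = (16 * t) * t * t" by (simp add: numeral_eq_Suc)
      also have "\<dots> \<le> \<epsilon> * 1 * t" using t True \<epsilon> by (intro mult_mono) auto
      finally show ?thesis using t True by simp
    qed
    then show ?thesis using \<epsilon> by (intro exI[of _ "\<epsilon> / 16"]) auto
  next
    case False
    with c obtain n where n: "3/4 * (1/2)^n < c" using small_half_power[of c] by auto
    obtain \<delta> where \<delta>: "\<delta> > 0" "\<And>t. t \<in> {0..1} \<Longrightarrow> \<bar>t - c\<bar> < \<delta> \<Longrightarrow>
        N (G n t - G n c - (t - c) *\<^sub>R F n c) \<le> \<epsilon> * \<bar>t - c\<bar>"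
      using C1_primitiveD(3)[OF F_G c \<epsilon>] by blast
    have "N (Q t - Q c - (t - c) *\<^sub>R f c) \<le> \<epsilon> * \<bar>t - c\<bar>"
      if t: "t \<in> {0..1}" "\<bar>t - c\<bar> < min \<delta> (c - 3/4 * (1/2)^n)" for t
    proof -
      have "3/4 * (1/2)^n \<le> t" "3/4 * (1/2)^n \<le> c" using t(2) n by linarith+
      then have "f c = F n c" "Q t - Q c = G n t - G n c"
        using f_eq_F Q_diff_eq_G[of n c t] c t by auto
      then show ?thesis using t \<delta>(2)[of t] by simp
    qed
    then show ?thesis using \<delta>(1) n by (intro exI[of _ "min \<delta> (c - 3/4 * (1/2)^n)"]) auto
  qed
next
  fix s t :: real assume "0 \<le> s" "s \<le> t" "t \<le> 1"
  then show "has_riemann_integral N f (Q t - Q s) s t" by (rule f_has_riemann_integral)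
qed

lemma Ave_f_not_jointly_continuous: "\<not> jointly_continuous N (Ave N f)"
proof
  assume "jointly_continuous N (Ave N f)"
  then have cont: "continuous_map (top_of_set ({0..1} \<times> {0..1})) (quasi_topology N) (Ave N f)"
    unfolding jointly_continuous_def .
  \<comment> \<open>\<open>Ave\<close> is 0 at the origin, whereas each block has an average of
    quasi-norm at least 1/2, at points that approach the origin.\<close>
  obtain U where U: "openin (quasi_topology N) U" "0 \<in> U" "\<And>y. y \<in> U \<Longrightarrow> N (y - 0) < 1/2"
    using ball_nhood[of "1/2" 0] by auto
  define W where "W = {z \<in> {0..1} \<times> {0..1}. Ave N f z \<in> U}"
  have "openin (top_of_set ({0..1} \<times> {0..1})) W"
    using cont U(1) unfolding continuous_map_def W_def by auto
  then have "\<forall>w\<in>W. \<exists>\<delta>>0. \<forall>z\<in>{0..1} \<times> {0..1}. dist z w < \<delta> \<longrightarrow> z \<in> W"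
    unfolding openin_euclidean_subtopology_iff by (rule conjunct2)
  moreover have "(0, 0) \<in> W"
    using U(2) by (simp add: Ave_diag W_def)
  ultimately obtain \<delta> where "\<delta> > 0"
    and W: "\<And>z. z \<in> {0..1} \<times> {0..1} \<Longrightarrow> dist z (0, 0) < \<delta> \<Longrightarrow> z \<in> W"
    by meson
  have \<delta>: "\<delta> > 0" "\<And>z. z \<in> {0..1} \<times> {0..1} \<Longrightarrow> dist z (0, 0) < \<delta> \<Longrightarrow> Ave N f z \<in> U"
    using \<open>\<delta> > 0\<close> W unfolding W_def by blast+
  obtain k where k: "(1/2)^k < \<delta> / 2" using real_arch_pow_inv[of "\<delta> / 2" "1/2"] \<delta>(1) by auto
  obtain s t where st: "(1/2)^Suc k \<le> s" "s < t" "t \<le> 3/4 * (1/2)^k" "(t - s) / 2 \<le> N (P k t - P k s)"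
    using large by blast
  have le1: "(1/2::real)^k \<le> 1" "(0::real) < (1/2)^k" by (auto simp: power_le_one)
  have I: "s \<in> {0..1}" "t \<in> {0..1}" using st le1 by auto
  have "dist (s, t) (0, 0) \<le> \<bar>s\<bar> + \<bar>t\<bar>"
    using norm_Pair_le[of s t] by (simp add: dist_norm)
  also have "\<dots> < \<delta>" using I st k le1 by auto
  finally have "Ave N f (s, t) \<in> U" using I by (intro \<delta>(2)) auto
  then have "N (Ave N f (s, t)) < 1/2" using U(3)[of "Ave N f (s, t)"] by simp
  moreover have "Q t - Q s = P k t - P k s" using st le1 by (intro Q_diff_eq_P) auto
  then have "N (Ave N f (s, t)) = N (P k t - P k s) / (t - s)"
    using st(2) I by (simp add: Ave_eq[OF f_Q] N_scaleR)
  moreover have "1/2 \<le> N (P k t - P k s) / (t - s)" using st by (simp add: pos_le_divide_eq)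
  ultimately show False by linarith
qed

end

theorem theorem1p3:
  fixes N :: "'a::real_vector \<Rightarrow> real"
  assumes "quasi_banach N"
    and "\<not> locally_convex (quasi_topology N)"
  shows "\<exists>f :: real \<Rightarrow> 'a.
           continuous_map (top_of_set {0..1}) (quasi_topology N) f \<and>
           riemann_integrable N f 0 1 \<and>
           bounded_on_square N (Ave N f) \<and>
           separately_continuous N (Ave N f) \<and>
           \<not> jointly_continuous N (Ave N f)"
proof -
  have qn: "quasi_norm N" and complete: "quasi_complete N"
    using assms(1) by (auto simp: quasi_banach_def)
  obtain \<kappa> where \<kappa>: "\<kappa> \<ge> 1" "\<And>x y. N (x + y) \<le> \<kappa> * (N x + N y)"
    using qn unfolding quasi_norm_def by blast
  interpret quasi_normed N \<kappa>
    using qn \<kappa> by unfold_locales (auto simp: quasi_norm_def)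
  have unb: "\<exists>y\<in>convex hull {x. N x \<le> 1}. C < N y" for C
    using assms(2) locally_convexI[of C] by (force simp: not_less)
  define block where "block k h P \<longleftrightarrow>
    C1_primitive h P \<and> (\<forall>u. u \<notin> {(1/2)^Suc k<..<3/4 * (1/2)^k} \<longrightarrow> h u = 0) \<and>
    (\<forall>u. N (h u) \<le> (1/8)^k / \<kappa> ^ (k + 3)) \<and>
    (\<forall>p s t. p tagged_division_of {s..t} \<longrightarrow> t - s \<le> 1 \<longrightarrow> N (riemann_sum h p) \<le> (1/8)^k / \<kappa> ^ (k + 3)) \<and>
    (\<forall>s\<in>{0..1}. \<forall>t\<in>{0..1}. N (P t - P s) \<le> \<bar>t - s\<bar>) \<and>
    (\<exists>s t. (1/2)^Suc k \<le> s \<and> s < t \<and> t \<le> 3/4 * (1/2)^k \<and> (t - s) / 2 \<le> N (P t - P s))"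
    for k :: nat and h P
  have "\<exists>h P. block k h P" for k
    unfolding block_def
  proof (rule block_exists[OF unb])
    have "(1/2::real)^k \<le> 1" by (simp add: power_le_one)
    then show "3/4 * (1/2::real)^k \<le> 1" by simp
  qed (use \<kappa>_pos in auto)
  then obtain h P where hP: "\<And>k. block k (h k) (P k)" by metis
  interpret block_sequence N \<kappa> h P
    by unfold_locales (use hP complete in \<open>unfold block_def, blast\<close>)+
  \<comment> \<open>One constant serves both for the values on the diagonal and for the difference
    quotients of \<open>Q\<close>.\<close>
  define B where "B = max 2 (\<kappa> * (1 + 4 * \<kappa>))"
  have Lip: "N (Q t - Q s) \<le> B * \<bar>t - s\<bar>" if "s \<in> {0..1}" "t \<in> {0..1}" for s t
    using Q_Lip[OF that] mult_right_mono[of "\<kappa> * (1 + 4 * \<kappa>)" B "\<bar>t - s\<bar>"] unfolding B_def by linarith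
  have "N (f u) \<le> B" if "u \<in> {0..1}" for u
    using N_f_le[OF that] that unfolding B_def by auto
  then have "bounded_on_square N (Ave N f)" using Lip by (rule Ave_bounded[OF f_Q])
  moreover have "separately_continuous N (Ave N f)"
    using Lip by (rule Ave_separately_continuous[OF f_Q])
  moreover have "riemann_integrable N f 0 1"
    unfolding riemann_integrable_def using f_has_riemann_integral[of 0 1] by auto
  ultimately show ?thesis
    using C1_primitive_continuous_map[OF f_Q] Ave_f_not_jointly_continuous by blast
qed

end
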